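(* In the Gaussian Bayesian spanning forest model with known number of clusters $K_{0,n}$ and oracle partition described in the context, so that $f^{(n)}_{st}=\zeta(\sigma_n)\exp\{-d_{st}^2/(2\sigma_n^2)\}$ with $\sigma_n>0$, let $y^{(n)}\sim P_0^{(n)}$ for each $n$. Assume: (A1) there exist constants $C_1,C_2>0$ (not depending on $n$ or on the data) such that for all sufficiently large $n$, $C_1\delta_n\le \min_{i\in[n]} r_n(y_i)\le\max_{i\in[n]} r_n(y_i)\le C_2\delta_n$; (A2) $K_{0,n}=o(\sqrt n)$ as $n\to\infty$. Then, for any positive sequences $\{a_n'\}$ and $\{b_n'\}$ satisfying $\sigma_n^2\log(n)/(a_n'-b_n')=o(1)$, there is a constant $C>0$ independent of $n$ such that for all sufficiently large $n$ $$\mathbb E_{P_0^{(n)}}\big[\mathbb E(d_H(\mathcal V_n,(V_1^{0,n},\dots,V_{K_{0,n}}^{0,n}))\mid y^{(n)})\big]\le C\Big\{\exp\Big(-\frac{a_n'-b_n'}{2\sigma_n^2}+n\log(K_{0,n}+1)\Big)+n^3\Big[\sup_{k\ne\ell;\,k,\ell\in[K_{0,n}]}P(D_{k\ell}^2<a_n')+\sup_{k'\in[K_{0,n}]}P(D_{k'k'}^2>b_n')\Big]\Big\}.$$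
   Context: Oracle. $(V_1^0,V_2^0,\dots)$ is a fixed partition of the positive integers into disjoint sets. For each $n$, $[n]=\{1,\dots,n\}$, $V_k^{0,n}=V_k^0\cap[n]$, and $K_{0,n}$ is the number of nonempty sets among these, labelled $k=1,\dots,K_{0,n}$. Data. For each $n$ the data are $y^{(n)}=(y_1,\dots,y_n)$ (a triangular array: data for different $n$ need not be nested) with law $P_0^{(n)}$. It is assumed that the joint law of a pair $(y_s,y_t)$, $s\ne t$, depends only on the oracle cluster labels of $s$ and $t$ (this holds e.g. when the $y_i$ are independent with a law depending only on the cluster of $i$). $D_{k\ell}$ denotes a random variable distributed as $d_{st}$ for $s\in V_k^{0,n}$, $t\in V_\ell^{0,n}$, $s\ne t$. Suprema of probabilities over an empty index set are $0$. Distance and kernel. The data lie either in Euclidean space $\mathbb R^p$, with $d_{st}=\|y_s-y_t\|_2$ and $\zeta(\sigma)=(\sqrt{2\pi}\sigma)^{-p}$, or in a homogeneous Riemannian manifold, with $d_{st}$ the geodesic distance between $y_s$ and $y_t$ and $\zeta(\sigma)$ the normalizing constant of the Riemannian Gaussian density $\zeta(\sigma)\exp\{-d_g(\cdot,z)^2/(2\sigma^2)\}$, which by homogeneity does not depend on the centre $z$. BSF model with known number of clusters. For each $n$ there are weights $f^{(n)}_{st}$ as in the claim ($s\ne t$), a positive root kernel $r_n$, and a number $\delta_n>0$. For nonempty $V\subset[n]$, $L_V$ is the graph Laplacian on $V$ with edge weights $f^{(n)}_{st}$ (off-diagonal entries $-f^{(n)}_{st}$, diagonal entries $\sum_{t\in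 V,t\neq s}f^{(n)}_{st}$), and $|L_V[1]|$ is the determinant of $L_V$ with first row and column removed (equal to $1$ if $|V|=1$). With $K_{0,n}$ known, the posterior of $\mathcal V_n$ is supported on ordered partitions $(V_1,\dots,V_{K_{0,n}})$ of $[n]$ into $K_{0,n}$ nonempty sets, with probability proportional to $\prod_{k=1}^{K_{0,n}}\big[\big(\sum_{i\in V_k}r_n(y_i)\big)|L_{V_k}[1]|\big]$. The inner expectation $\mathbb E(\cdot\mid y^{(n)})$ is with respect to this posterior. Hamming distance. For two partitions of $[n]$ into $K_{0,n}$ blocks with label vectors $z^1,z^2\in[K_{0,n}]^n$, $d_H=\min_\psi\sum_{i=1}^n\mathbf 1\{\psi(z^1_i)\ne z^2_i\}$, the minimum being over bijections $\psi$ of $[K_{0,n}]$. *)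

theory Defs
  imports
    "HOL-Probability.Probability"
    "HOL-Combinatorics.Permutations"
    "HOL-Library.Landau_Symbols"
    "Jordan_Normal_Form.Determinant"
begin

section \<open>Homogeneous Riemannian manifolds\<close>

text \<open>
  A manifold is a whole type with a set of charts (domain and coordinate map) into
  \<open>real ^ 'p\<close>.  A metric tensor is given by its coordinate expressions: \<open>g c x u v\<close> is the inner
  product at the point \<open>x\<close> of the tangent vectors with coordinates \<open>u\<close>, \<open>v\<close> in the chart \<open>c\<close>.
\<close>

type_synonym ('a, 'p) chart = "'a set \<times> ('a \<Rightarrow> real ^ 'p)"
type_synonym ('a, 'p) metric_tensor =
  "('a, 'p) chart \<Rightarrow> 'a \<Rightarrow> real ^ 'p \<Rightarrow> real ^ 'p \<Rightarrow> real"

text \<open>Continuous differentiability of order \<open>k\<close> on an open set, by iterated directional derivatives.\<close>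

primrec Ck_on :: "nat \<Rightarrow> 'a::euclidean_space set \<Rightarrow> ('a \<Rightarrow> 'b::real_normed_vector) \<Rightarrow> bool" where
  "Ck_on 0 S f \<longleftrightarrow> continuous_on S f"
| "Ck_on (Suc k) S f \<longleftrightarrow> (\<forall>x\<in>S. f differentiable (at x)) \<and>
     (\<forall>v. Ck_on k S (\<lambda>x. frechet_derivative f (at x) v))"

definition smooth_on :: "'a::euclidean_space set \<Rightarrow> ('a \<Rightarrow> 'b::real_normed_vector) \<Rightarrow> bool" where
  "smooth_on S f \<longleftrightarrow> (\<forall>k. Ck_on k S f)"

definition chart_inv :: "('a, 'p::finite) chart \<Rightarrow> real ^ 'p \<Rightarrow> 'a" where
  "chart_inv c = inv_into (fst c) (snd c)"

definition local_rep ::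
    "('a, 'p::finite) chart \<Rightarrow> ('a \<Rightarrow> 'a) \<Rightarrow> ('a, 'p) chart \<Rightarrow> real ^ 'p \<Rightarrow> real ^ 'p" where
  "local_rep c f c' = (\<lambda>z. snd c' (f (chart_inv c z)))"

definition smooth_map ::
    "('a::topological_space, 'p::finite) chart set \<Rightarrow> ('a \<Rightarrow> 'a) \<Rightarrow> bool" where
  "smooth_map A f \<longleftrightarrow> continuous_on UNIV f \<and>
     (\<forall>c\<in>A. \<forall>c'\<in>A. smooth_on (snd c ` (fst c \<inter> f -` fst c')) (local_rep c f c'))"

definition preserves_metric ::
    "('a, 'p::finite) chart set \<Rightarrow> ('a, 'p) metric_tensor \<Rightarrow> ('a \<Rightarrow> 'a) \<Rightarrow> bool" where
  "preserves_metric A g f \<longleftrightarrow>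
     (\<forall>c\<in>A. \<forall>c'\<in>A. \<forall>x\<in>fst c \<inter> f -` fst c'. \<forall>u v.
        g c x u v =
          g c' (f x) (frechet_derivative (local_rep c f c') (at (snd c x)) u)
                     (frechet_derivative (local_rep c f c') (at (snd c x)) v))"

text \<open>For \<open>f = id\<close> the two notions above are the smoothness of the transition maps and the
  transformation rule of the coordinate expressions of a tensor.\<close>

definition smooth_atlas :: "('a::topological_space, 'p::finite) chart set \<Rightarrow> bool" where
  "smooth_atlas A \<longleftrightarrow>
     (\<forall>(U, \<phi>)\<in>A. open U \<and> open (\<phi> ` U) \<and> (\<exists>\<psi>. homeomorphism U (\<phi> ` U) \<phi> \<psi>)) \<and>
     (\<Union>c\<in>A. fst c) = UNIV \<and>
     smooth_map A id"

definition riemannian_metric ::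
    "('a, 'p::finite) chart set \<Rightarrow> ('a, 'p) metric_tensor \<Rightarrow> bool" where
  "riemannian_metric A g \<longleftrightarrow>
     (\<forall>c\<in>A. \<forall>x\<in>fst c. bilinear (g c x) \<and> (\<forall>u v. g c x u v = g c x v u) \<and>
        (\<forall>u. u \<noteq> 0 \<longrightarrow> g c x u u > 0)) \<and>
     (\<forall>c\<in>A. \<forall>u v. smooth_on (snd c ` fst c) (\<lambda>z. g c (chart_inv c z) u v)) \<and>
     preserves_metric A g id"

definition riemannian_isometry ::
    "('a::topological_space, 'p::finite) chart set \<Rightarrow> ('a, 'p) metric_tensor \<Rightarrow> ('a \<Rightarrow> 'a) \<Rightarrow> bool"
  where
  "riemannian_isometry A g f \<longleftrightarrow>
     bij f \<and> smooth_map A f \<and> smooth_map A (inv_into UNIV f) \<and> preserves_metric A g f"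

definition piecewise_C1_curve ::
    "('a::topological_space, 'p::finite) chart set \<Rightarrow> (real \<Rightarrow> 'a) \<Rightarrow> bool" where
  "piecewise_C1_curve A \<gamma> \<longleftrightarrow> path \<gamma> \<and>
     (\<forall>(U, \<phi>)\<in>A. \<forall>a b. {a..b} \<subseteq> {0..1} \<and> \<gamma> ` {a..b} \<subseteq> U \<longrightarrow>
        (\<phi> \<circ> \<gamma>) piecewise_C1_differentiable_on {a..b})"

text \<open>The speed does not depend on the chosen chart, by the transformation rule; at the finitely
  many break points of the curve its value is irrelevant.\<close>

definition curve_speed ::
    "('a, 'p::finite) chart set \<Rightarrow> ('a, 'p) metric_tensor \<Rightarrow> (real \<Rightarrow> 'a) \<Rightarrow> real \<Rightarrow> real" where
  "curve_speed A g \<gamma> t =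
     (let c = (SOME c. c \<in> A \<and> \<gamma> t \<in> fst c);
          v = vector_derivative (snd c \<circ> \<gamma>) (at t)
      in sqrt (g c (\<gamma> t) v v))"

definition curve_length ::
    "('a, 'p::finite) chart set \<Rightarrow> ('a, 'p) metric_tensor \<Rightarrow> (real \<Rightarrow> 'a) \<Rightarrow> ennreal" where
  "curve_length A g \<gamma> = (\<integral>\<^sup>+t\<in>{0..1}. ennreal (curve_speed A g \<gamma> t) \<partial>lborel)"

definition geodesic_distance ::
    "('a::topological_space, 'p::finite) chart set \<Rightarrow> ('a, 'p) metric_tensor \<Rightarrow> 'a \<Rightarrow> 'a \<Rightarrow> ennreal"
  where
  "geodesic_distance A g x y =
     Inf {curve_length A g \<gamma> | \<gamma>. piecewise_C1_curve A \<gamma> \<and> pathstart \<gamma> = x \<and> pathfinish \<gamma> = y}"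

text \<open>The distance of the type is the geodesic distance.  Its finiteness makes the manifold
  connected.\<close>

definition homogeneous_riemannian_manifold ::
    "('a::metric_space, 'p::finite) chart set \<Rightarrow> ('a, 'p) metric_tensor \<Rightarrow> bool" where
  "homogeneous_riemannian_manifold A g \<longleftrightarrow>
     smooth_atlas A \<and> riemannian_metric A g \<and>
     (\<forall>x y. ennreal (dist x y) = geodesic_distance A g x y) \<and>
     (\<forall>x y. \<exists>f. riemannian_isometry A g f \<and> f x = y)"

definition riemannian_volume ::
    "('a::topological_space, 'p::finite) chart set \<Rightarrow> ('a, 'p) metric_tensor \<Rightarrow> 'a measure \<Rightarrow> bool"
  where
  "riemannian_volume A g vol \<longleftrightarrow> sets vol = sets borel \<and>
     (\<forall>c\<in>A. \<forall>B\<in>sets borel. B \<subseteq> fst c \<longrightarrow>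
        emeasure vol B =
          (\<integral>\<^sup>+z\<in>snd c ` B.
             ennreal (sqrt (Determinants.det
               (\<chi> i j. g c (chart_inv c z) (axis i 1) (axis j 1)))) \<partial>lborel))"


section \<open>The two kinds of data space, with the normalizing constant of the Gaussian kernel\<close>

text \<open>Here \<open>\<iota>\<close> is an identification of the data space with \<open>real ^ 'p\<close>; for data of type \<open>real ^ 'p\<close> it
  can be taken to be the identity.\<close>

definition euclidean_gaussian :: "('a::metric_space \<Rightarrow> real ^ 'p::finite) \<Rightarrow> (real \<Rightarrow> real) \<Rightarrow> bool"
  where
  "euclidean_gaussian \<iota> \<zeta> \<longleftrightarrow>
     bij \<iota> \<and> (\<forall>x y. dist x y = norm (\<iota> x - \<iota> y)) \<and>
     (\<forall>\<sigma>>0. \<zeta> \<sigma> = 1 / (sqrt (2 * pi) * \<sigma>) ^ CARD('p))"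

definition riemannian_gaussian ::
    "('a::metric_space, 'p::finite) chart set \<Rightarrow> ('a, 'p) metric_tensor \<Rightarrow> 'a measure \<Rightarrow>
     (real \<Rightarrow> real) \<Rightarrow> bool" where
  "riemannian_gaussian A g vol \<zeta> \<longleftrightarrow>
     homogeneous_riemannian_manifold A g \<and> riemannian_volume A g vol \<and>
     (\<forall>\<sigma>>0. \<forall>z. (\<integral>\<^sup>+x. ennreal (\<zeta> \<sigma> * exp (- (dist x z)\<^sup>2 / (2 * \<sigma>\<^sup>2))) \<partial>vol) = 1)"

definition gaussian_weight ::
    "(real \<Rightarrow> real) \<Rightarrow> real \<Rightarrow> (nat \<Rightarrow> 'a::metric_space) \<Rightarrow> nat \<Rightarrow> nat \<Rightarrow> real" where
  "gaussian_weight \<zeta> \<sigma> y s t = \<zeta> \<sigma> * exp (- (dist (y s) (y t))\<^sup>2 / (2 * \<sigma>\<^sup>2))"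


section \<open>Posterior of the Bayesian spanning forest model, known number of clusters\<close>

definition laplacian :: "(nat \<Rightarrow> nat \<Rightarrow> real) \<Rightarrow> nat set \<Rightarrow> real mat" where
  "laplacian f V =
     (let vs = sorted_list_of_set V in
      mat (card V) (card V) (\<lambda>(i, j).
        if i = j then (\<Sum>t\<in>V - {vs ! i}. f (vs ! i) t) else - f (vs ! i) (vs ! j)))"

text \<open>For a one-element \<open>V\<close> this is the determinant of the empty matrix, which is 1.\<close>

definition laplacian_minor :: "(nat \<Rightarrow> nat \<Rightarrow> real) \<Rightarrow> nat set \<Rightarrow> real" where
  "laplacian_minor f V = Determinant.det (mat_delete (laplacian f V) 0 0)"

definition ordered_partitions :: "nat \<Rightarrow> nat \<Rightarrow> (nat \<Rightarrow> nat set) set" where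
  "ordered_partitions n K =
     {W \<in> {1..K} \<rightarrow>\<^sub>E Pow {1..n}.
        (\<forall>k\<in>{1..K}. W k \<noteq> {}) \<and> disjoint_family_on W {1..K} \<and> (\<Union>k\<in>{1..K}. W k) = {1..n}}"

definition posterior_weight ::
    "(nat \<Rightarrow> nat \<Rightarrow> real) \<Rightarrow> ('a \<Rightarrow> real) \<Rightarrow> (nat \<Rightarrow> 'a) \<Rightarrow> nat \<Rightarrow> (nat \<Rightarrow> nat set) \<Rightarrow> real" where
  "posterior_weight f r y K W = (\<Prod>k\<in>{1..K}. (\<Sum>i\<in>W k. r (y i)) * laplacian_minor f (W k))"

definition posterior_prob ::
    "(nat \<Rightarrow> nat \<Rightarrow> real) \<Rightarrow> ('a \<Rightarrow> real) \<Rightarrow> (nat \<Rightarrow> 'a) \<Rightarrow> nat \<Rightarrow> nat \<Rightarrow> (nat \<Rightarrow> nat set) \<Rightarrow> real"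
  where
  "posterior_prob f r y n K W =
     posterior_weight f r y K W / (\<Sum>W'\<in>ordered_partitions n K. posterior_weight f r y K W')"

definition posterior_expectation ::
    "(nat \<Rightarrow> nat \<Rightarrow> real) \<Rightarrow> ('a \<Rightarrow> real) \<Rightarrow> (nat \<Rightarrow> 'a) \<Rightarrow> nat \<Rightarrow> nat \<Rightarrow>
     ((nat \<Rightarrow> nat set) \<Rightarrow> real) \<Rightarrow> real" where
  "posterior_expectation f r y n K h =
     (\<Sum>W\<in>ordered_partitions n K. h W * posterior_prob f r y n K W)"


section \<open>Hamming distance\<close>

definition label :: "nat \<Rightarrow> (nat \<Rightarrow> nat set) \<Rightarrow> nat \<Rightarrow> nat" where
  "label K W i = (THE k. k \<in> {1..K} \<and> i \<in> W k)"

definition hamming :: "nat \<Rightarrow> nat \<Rightarrow> (nat \<Rightarrow> nat set) \<Rightarrow> (nat \<Rightarrow> nat set) \<Rightarrow> nat" where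
  "hamming n K W1 W2 =
     Min {card {i \<in> {1..n}. \<psi> (label K W1 i) \<noteq> label K W2 i} | \<psi>. \<psi> permutes {1..K}}"


section \<open>Oracle partition and between/within cluster distances\<close>

definition oracle_indices :: "(nat \<Rightarrow> nat set) \<Rightarrow> nat \<Rightarrow> nat set" where
  "oracle_indices V n = {k. 1 \<le> k \<and> V k \<inter> {1..n} \<noteq> {}}"

definition oracle_K :: "(nat \<Rightarrow> nat set) \<Rightarrow> nat \<Rightarrow> nat" where
  "oracle_K V n = card (oracle_indices V n)"

text \<open>The nonempty traces on \<open>{1..n}\<close>, relabelled by \<open>1, ..., oracle_K V n\<close> through \<open>lab n\<close>.\<close>

definition oracle_block ::
    "(nat \<Rightarrow> nat set) \<Rightarrow> (nat \<Rightarrow> nat \<Rightarrow> nat) \<Rightarrow> nat \<Rightarrow> nat \<Rightarrow> nat set" where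
  "oracle_block V lab n k = V (lab n k) \<inter> {1..n}"

definition same_cluster :: "(nat \<Rightarrow> nat set) \<Rightarrow> nat \<Rightarrow> nat \<Rightarrow> bool" where
  "same_cluster V s t \<longleftrightarrow> (\<exists>k\<ge>1. s \<in> V k \<and> t \<in> V k)"

definition pair_law :: "(nat \<Rightarrow> 'a::metric_space) measure \<Rightarrow> nat \<Rightarrow> nat \<Rightarrow> ('a \<times> 'a) measure" where
  "pair_law P s t = distr P (borel \<Otimes>\<^sub>M borel) (\<lambda>y. (y s, y t))"

text \<open>The law of the distance between an observation of the cluster \<open>S\<close> and a different observation
  of the cluster \<open>T\<close>.  It is well defined if there is such a pair and the pair laws depend only on
  the clusters.\<close>

definition distance_law ::
    "(nat \<Rightarrow> 'a::metric_space) measure \<Rightarrow> nat set \<Rightarrow> nat set \<Rightarrow> real measure" where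
  "distance_law P S T =
     (THE \<mu>. \<exists>s\<in>S. \<exists>t\<in>T. s \<noteq> t \<and> \<mu> = distr P borel (\<lambda>y. dist (y s) (y t)))"

definition sup_prob :: "'i set \<Rightarrow> ('i \<Rightarrow> real) \<Rightarrow> real" where
  "sup_prob I p = (if I = {} then 0 else (SUP i\<in>I. p i))"

definition between_prob ::
    "(nat \<Rightarrow> 'a::metric_space) measure \<Rightarrow> (nat \<Rightarrow> nat set) \<Rightarrow> nat \<Rightarrow> real \<Rightarrow> real" where
  "between_prob P B K a =
     sup_prob {(k, l). k \<in> {1..K} \<and> l \<in> {1..K} \<and> k \<noteq> l}
       (\<lambda>(k, l). measure (distance_law P (B k) (B l)) {x. x\<^sup>2 < a})"

text \<open>One-element clusters contain no pair of different observations, so they do not contribute.\<close>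

definition within_prob ::
    "(nat \<Rightarrow> 'a::metric_space) measure \<Rightarrow> (nat \<Rightarrow> nat set) \<Rightarrow> nat \<Rightarrow> real \<Rightarrow> real" where
  "within_prob P B K b =
     sup_prob {k \<in> {1..K}. \<exists>s\<in>B k. \<exists>t\<in>B k. s \<noteq> t}
       (\<lambda>k. measure (distance_law P (B k) (B k)) {x. x\<^sup>2 > b})"

end

theory Submission
  imports Defs "HOL-Real_Asymp.Real_Asymp"
begin

text \<open>
  By the matrix-tree theorem, the posterior weight of a partition is, up to the root factors, a sum
  over spanning forests with one tree per block.  A forest whose trees do not form the oracle
  partition has crossing edges.  Cutting them and attaching the resulting trees to other roots of
  their oracle cluster replaces each crossing edge by an edge inside a cluster.  If all distances
  within clusters are at most \<open>sqrt b\<close> and all distances between clusters at least \<open>sqrt a\<close>, each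
  replacement gains a factor \<open>1/\<epsilon>\<close>, where \<open>\<epsilon> = exp (- (a - b) / (2 * \<sigma>\<^sup>2))\<close>, and the rate
  assumption makes \<open>n\<^sup>2 * \<epsilon>\<close> small enough to sum over all sets of crossing edges.  The choice of
  roots and the root factors cost \<open>(c * n\<^sup>2) ^ K\<close>, which is at most \<open>(K + 1) ^ n\<close> up to the remaining
  powers of \<open>n\<close> because \<open>K \<le> sqrt n\<close>.  The exceptional event on the distances is controlled by a
  union bound over pairs, the Hamming distance there being at most \<open>n\<close>.  For \<open>a \<le> b\<close> the first term
  of the bound already exceeds \<open>n\<close>.
\<close>

section \<open>The matrix-tree theorem for parent maps\<close>

text \<open>The powers of the edge weight balance because a forest with one tree per block has
  exactly as many roots as there are clusters. Cutting the crossing edges with tails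
  \<open>X\<close> leaves \<open>card R + card X\<close> roots, where \<open>R\<close> is the old
  root set. The obstacle is that these roots may be spread unevenly and that a cluster may receive
  none, so there is no canonical oracle forest to compare with. The remedy is an inequality between
  sums for each cluster: if it contains \<open>j\<close> of the roots, \<open>F\<close> is its
  forest sum and \<open>\<tau>\<close> its tree sum, then \<open>m ^ j * F \<le> m * \<tau>\<close>.
  It also covers \<open>j = 0\<close>, where \<open>F = 0\<close> because a rootless cluster carries
  no forest. In the product over the clusters only the total number of roots survives, and each cut
  edge pays with its weight, at most \<open>\<epsilon> * m\<close>, for one missing factor
  \<open>m\<close>. Keeping only the oracle term in the normalizing constant then cancels the tree
  sums of the oracle clusters, which therefore never have to be estimated.\<close>

text \<open>A rooted forest is encoded by the map from its non-root vertices \<open>U\<close> to their parents.  For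
  finite \<open>U\<close> it is a forest iff iterating the map from any vertex leaves \<open>U\<close>, that is, iff
  no nonempty subset of \<open>U\<close> is closed under it.\<close>

definition acyclic_map :: "('a \<Rightarrow> 'a) \<Rightarrow> 'a set \<Rightarrow> bool" where
  "acyclic_map \<phi> U \<longleftrightarrow> (\<forall>N\<subseteq>U. \<phi> ` N \<subseteq> N \<longrightarrow> N = {})"

text \<open>The set of allowed parents depends on the vertex, so that one notion covers both
  arbitrary forests on a vertex set and forests whose edges stay inside given blocks.\<close>

definition forests :: "('a \<Rightarrow> 'a set) \<Rightarrow> 'a set \<Rightarrow> ('a \<Rightarrow> 'a) set" where
  "forests T U = {\<phi> \<in> PiE U T. acyclic_map \<phi> U}"

definition forest_sum :: "('a \<Rightarrow> 'a \<Rightarrow> real) \<Rightarrow> ('a \<Rightarrow> 'a set) \<Rightarrow> 'a set \<Rightarrow> real" where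
  "forest_sum w T U = (\<Sum>\<phi>\<in>forests T U. \<Prod>i\<in>U. w i (\<phi> i))"

lemma acyclic_mapD: "acyclic_map \<phi> U \<Longrightarrow> N \<subseteq> U \<Longrightarrow> (\<And>i. i \<in> N \<Longrightarrow> \<phi> i \<in> N) \<Longrightarrow> N = {}"
  unfolding acyclic_map_def by blast

lemma acyclic_map_subset: "acyclic_map \<phi> U \<Longrightarrow> U' \<subseteq> U \<Longrightarrow> acyclic_map \<phi> U'"
  unfolding acyclic_map_def by blast

lemma acyclic_map_cong:
  assumes "acyclic_map \<phi> U" "\<And>i. i \<in> U \<Longrightarrow> \<phi> i = \<psi> i"
  shows "acyclic_map \<psi> U"
  unfolding acyclic_map_def
proof (intro allI impI)
  fix N assume "N \<subseteq> U" "\<psi> ` N \<subseteq> N"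
  then show "N = {}" using assms(2) by (intro acyclic_mapD[OF assms(1)]) fastforce+
qed

lemma finite_forests:
  assumes "finite U" "\<And>i. i \<in> U \<Longrightarrow> finite (T i)"
  shows "finite (forests T U)"
  unfolding forests_def using finite_PiE[of U T] assms by auto

lemma forest_sum_nonneg:
  assumes "\<And>i j. i \<in> U \<Longrightarrow> j \<in> T i \<Longrightarrow> 0 \<le> w i j"
  shows "0 \<le> forest_sum w T U"
  unfolding forest_sum_def forests_def using assms by (auto intro!: sum_nonneg prod_nonneg)

text \<open>This is the Laplacian of the directed graph with edges from \<open>i\<close> to
  \<open>\<phi> i\<close>, reduced to \<open>xs\<close>: an edge that leaves \<open>xs\<close>
  contributes only its diagonal entry 1, and a fixed point gives a zero row.\<close>

definition pointer_mat :: "'a list \<Rightarrow> ('a \<Rightarrow> 'a) \<Rightarrow> real mat" where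
  "pointer_mat xs \<phi> = mat (length xs) (length xs)
     (\<lambda>(i, j). of_bool (xs ! i = xs ! j) - of_bool (\<phi> (xs ! i) = xs ! j))"

text \<open>A permutation with a nonzero Leibniz term moves a vertex only to its parent. The moved
  vertices are therefore closed under \<open>\<phi>\<close>, so there are none, and only the
  identity remains. Its term is 1 because \<open>\<phi>\<close> has no fixed point in
  \<open>xs\<close>.\<close>

lemma det_pointer_mat_acyclic:
  assumes xs: "distinct xs" and ac: "acyclic_map \<phi> (set xs)"
  shows "Determinant.det (pointer_mat xs \<phi>) = 1"
proof -
  define n where "n = length xs"
  let ?e = "\<lambda>p i. of_bool (xs ! i = xs ! p i) - of_bool (\<phi> (xs ! i) = xs ! p i) :: real"
  have A: "pointer_mat xs \<phi> \<in> carrier_mat n n" by (simp add: pointer_mat_def n_def)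
  have zero: "(\<Prod>i=0..<n. ?e p i) = 0" if p: "p permutes {0..<n}" and "p \<noteq> id" for p
  proof (rule ccontr)
    assume nz: "(\<Prod>i=0..<n. ?e p i) \<noteq> 0"
    have pin: "p i < n" if "i < n" for i using permutes_in_image[OF p, of i] that by auto
    define N where "N = (\<lambda>i. xs ! i) ` {i. i < n \<and> p i \<noteq> i}"
    have "N = {}"
    proof (rule acyclic_mapD[OF ac])
      show "N \<subseteq> set xs" by (auto simp: N_def n_def)
      fix x assume "x \<in> N"
      then obtain i where i: "x = xs ! i" "i < n" "p i \<noteq> i" by (auto simp: N_def)
      have "?e p i \<noteq> 0" using nz i(2) by auto
      moreover have "xs ! i \<noteq> xs ! p i"
        using i pin[OF i(2)] xs by (simp add: nth_eq_iff_index_eq n_def)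
      ultimately have "\<phi> x = xs ! p i" using i by auto
      moreover have "p (p i) \<noteq> p i" using i(3) permutes_inj[OF p] by (auto dest: injD)
      ultimately show "\<phi> x \<in> N" using pin[OF i(2)] by (auto simp: N_def)
    qed
    then have "p i = i" for i
      using permutes_not_in[OF p, of i] by (cases "i < n") (auto simp: N_def)
    then show False using \<open>p \<noteq> id\<close> by auto
  qed
  have nofix: "\<phi> x \<noteq> x" if "x \<in> set xs" for x
    using acyclic_mapD[OF ac, of "{x}"] that by auto
  have "Determinant.det (pointer_mat xs \<phi>)
      = (\<Sum>p\<in>{p. p permutes {0..<n}}. signof p * (\<Prod>i=0..<n. ?e p i))"
    unfolding det_def'[OF A]
    by (intro sum.cong refl arg_cong2[where f = "(*)"] prod.cong)
       (auto simp: pointer_mat_def n_def dest: permutes_in_image)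
  also have "\<dots> = (\<Sum>p\<in>{id}. signof p * (\<Prod>i=0..<n. ?e p i))"
    using zero by (intro sum.mono_neutral_right) (auto simp: finite_permutations permutes_id)
  also have "\<dots> = 1"
    using nofix by (auto simp: n_def intro!: prod.neutral)
  finally show ?thesis .
qed

text \<open>The indicator vector of the largest closed set \<open>M\<close> lies in the kernel. This
  needs \<open>x \<in> M\<close> to be equivalent to \<open>\<phi> x \<in> M\<close>: one direction
  is closedness, the other is maximality, which is why the union of all closed sets is
  taken.\<close>

lemma det_pointer_mat_cyclic:
  assumes xs: "distinct xs" and nac: "\<not> acyclic_map \<phi> (set xs)"
  shows "Determinant.det (pointer_mat xs \<phi>) = 0"
proof -
  define n where "n = length xs"
  have A: "pointer_mat xs \<phi> \<in> carrier_mat n n" by (simp add: pointer_mat_def n_def)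
  define M where "M = \<Union>{N. N \<subseteq> set xs \<and> \<phi> ` N \<subseteq> N}"
  have Msub: "M \<subseteq> set xs" unfolding M_def by (rule Union_least) simp
  have Mcl: "\<phi> ` M \<subseteq> M"
  proof (rule image_subsetI)
    fix x assume "x \<in> M"
    then obtain N where N: "N \<subseteq> set xs" "\<phi> ` N \<subseteq> N" "x \<in> N" unfolding M_def by blast
    then show "\<phi> x \<in> M" unfolding M_def by (intro UnionI[of N]) auto
  qed
  obtain N where "N \<subseteq> set xs" "\<phi> ` N \<subseteq> N" "N \<noteq> {}"
    using nac by (auto simp: acyclic_map_def)
  then have Mne: "M \<noteq> {}" unfolding M_def by (metis (mono_tags, lifting) Union_upper mem_Collect_eq subset_empty)
  have Mmax: "x \<in> M" if "x \<in> set xs" "\<phi> x \<in> M" for x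
  proof -
    have "insert x M \<subseteq> set xs" "\<phi> ` insert x M \<subseteq> insert x M" using that Msub Mcl by auto
    then show ?thesis unfolding M_def by (intro UnionI[of "insert x M"]) (simp_all add: M_def)
  qed
  define v where "v = vec n (\<lambda>i. of_bool (xs ! i \<in> M) :: real)"
  have "pointer_mat xs \<phi> *\<^sub>v v = 0\<^sub>v n"
  proof (rule eq_vecI)
    fix i assume "i < dim_vec (0\<^sub>v n :: real vec)"
    then have i: "i < n" by simp
    have sum_ind: "(\<Sum>j=0..<n. of_bool (y = xs ! j) * of_bool (xs ! j \<in> M)) = (of_bool (y \<in> M) :: real)"
      for y
    proof -
      have "(\<Sum>j=0..<n. of_bool (y = xs ! j) * of_bool (xs ! j \<in> M))
          = (\<Sum>x\<in>set xs. of_bool (y = x) * of_bool (x \<in> M) :: real)"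
        using sum.reindex_bij_betw[OF bij_betw_nth[OF xs refl refl],
            of "\<lambda>x. of_bool (y = x) * of_bool (x \<in> M) :: real"]
        by (simp add: n_def lessThan_atLeast0)
      also have "\<dots> = (\<Sum>x\<in>set xs. if y = x then of_bool (y \<in> M) else 0)"
        by (intro sum.cong) auto
      also have "\<dots> = of_bool (y \<in> M)" using Msub by auto
      finally show ?thesis .
    qed
    have "(pointer_mat xs \<phi> *\<^sub>v v) $ i
        = (\<Sum>j=0..<n. (of_bool (xs ! i = xs ! j) - of_bool (\<phi> (xs ! i) = xs ! j)) * of_bool (xs ! j \<in> M))"
      using i by (simp add: pointer_mat_def n_def v_def scalar_prod_def row_def)
    also have "\<dots> = of_bool (xs ! i \<in> M) - of_bool (\<phi> (xs ! i) \<in> M)"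
      by (simp add: left_diff_distrib sum_subtractf sum_ind)
    also have "\<dots> = 0" using Mcl Mmax[of "xs ! i"] i by (auto simp: n_def)
    finally show "(pointer_mat xs \<phi> *\<^sub>v v) $ i = 0\<^sub>v n $ i" using i by simp
  qed (simp add: pointer_mat_def n_def)
  moreover have "v \<noteq> 0\<^sub>v n"
  proof
    assume v0: "v = 0\<^sub>v n"
    obtain x where "x \<in> M" using Mne by auto
    then obtain i where "i < n" "xs ! i = x" using Msub by (metis in_set_conv_nth n_def subsetD)
    then show False using v0 \<open>x \<in> M\<close> by (auto simp: v_def dest!: arg_cong[where f = "\<lambda>u. u $ i"])
  qed
  ultimately show ?thesis
    using det_0_iff_vec_prod_zero_field[OF A] by (auto simp: v_def intro!: exI[of _ v])
qed

section \<open>Determinants of reduced Laplacians\<close>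

definition laplacian_entry :: "('a \<Rightarrow> 'a \<Rightarrow> real) \<Rightarrow> 'a set \<Rightarrow> 'a \<Rightarrow> 'a \<Rightarrow> real" where
  "laplacian_entry w V a b = (if a = b then \<Sum>t\<in>V - {a}. w a t else - w a b)"

text \<open>The rows are indexed by a list of vertices in any order, while the degrees are still
  taken over all of \<open>V\<close>. This leaves free which vertices are removed, as the change of
  root requires.\<close>

definition reduced_laplacian :: "('a \<Rightarrow> 'a \<Rightarrow> real) \<Rightarrow> 'a set \<Rightarrow> 'a list \<Rightarrow> real mat" where
  "reduced_laplacian w V xs =
     mat (length xs) (length xs) (\<lambda>(i, j). laplacian_entry w V (xs ! i) (xs ! j))"

text \<open>This exhibits a row of the Laplacian as a weighted sum of rows of pointer matrices, one
  for each possible parent \<open>t\<close>; the term \<open>t = a\<close> cancels.\<close>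

lemma laplacian_entry_sum:
  assumes "finite V" "b \<in> V"
  shows "laplacian_entry w V a b = (\<Sum>t\<in>V. w a t * (of_bool (a = b) - of_bool (t = b)))"
proof (cases "a = b")
  case True
  have "(\<Sum>t\<in>V. w a t * (of_bool (a = b) - of_bool (t = b))) = (\<Sum>t\<in>V - {a}. w a t)"
    using assms True by (intro sum.mono_neutral_cong_right) auto
  then show ?thesis using True by (simp add: laplacian_entry_def)
next
  case False
  have "(\<Sum>t\<in>V. w a t * (of_bool (a = b) - of_bool (t = b)))
      = (\<Sum>t\<in>{b}. w a t * (of_bool (a = b) - of_bool (t = b)))"
    using assms by (intro sum.mono_neutral_right) (use False in auto)
  then show ?thesis using False by (simp add: laplacian_entry_def)
qed

text \<open>The determinant is linear in each row, so choosing a parent in every row expands it into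
  a sum over all parent maps of the product of weights times the determinant of the pointer matrix.
  The latter is 1 for forests and 0 otherwise.\<close>

lemma det_reduced_laplacian:
  assumes xs: "distinct xs" and sub: "set xs \<subseteq> V" and fin: "finite V"
  shows "Determinant.det (reduced_laplacian w V xs) = forest_sum w (\<lambda>_. V) (set xs)"
proof -
  define n where "n = length xs"
  define U where "U = set xs"
  \<comment> \<open>Permutations act on positions in the list and parent maps on vertices.
    \<open>idx\<close> translates between them, so that a product of sums over positions becomes a
    sum over maps on \<open>U\<close>.\<close>
  define idx where "idx = inv_into {0..<n} ((!) xs)"
  have bij: "bij_betw ((!) xs) {0..<n} U"
    using bij_betw_nth[OF xs refl refl] by (simp add: n_def U_def lessThan_atLeast0)
  have idx: "idx (xs ! i) = i" if "i < n" for i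
    using bij_betw_inv_into_left[OF bij, of i] that by (simp add: idx_def)
  have pi_n: "p i < n" if "p permutes {0..<n}" "i < n" for p i
    using permutes_in_image[OF that(1), of i] that by auto
  let ?e = "\<lambda>\<phi> p i. of_bool (xs ! i = xs ! p i) - of_bool (\<phi> (xs ! i) = xs ! p i) :: real"
  have A: "reduced_laplacian w V xs \<in> carrier_mat n n"
    by (simp add: reduced_laplacian_def n_def)
  have B: "pointer_mat xs \<phi> \<in> carrier_mat n n" for \<phi>
    by (simp add: pointer_mat_def n_def)
  have expand: "(\<Prod>i=0..<n. reduced_laplacian w V xs $$ (i, p i))
      = (\<Sum>\<phi>\<in>PiE U (\<lambda>_. V). (\<Prod>x\<in>U. w x (\<phi> x)) * (\<Prod>i=0..<n. ?e \<phi> p i))"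
    if p: "p permutes {0..<n}" for p
  proof -
    let ?g = "\<lambda>x t. w x t * (of_bool (x = xs ! p (idx x)) - of_bool (t = xs ! p (idx x)))"
    have "(\<Prod>i=0..<n. reduced_laplacian w V xs $$ (i, p i))
        = (\<Prod>i=0..<n. \<Sum>t\<in>V. ?g (xs ! i) t)"
    proof (rule prod.cong)
      fix i assume "i \<in> {0..<n}"
      then have i: "i < n" by simp
      have "xs ! p i \<in> V" using pi_n[OF p i] sub by (auto simp: n_def)
      then show "reduced_laplacian w V xs $$ (i, p i) = (\<Sum>t\<in>V. ?g (xs ! i) t)"
        using i pi_n[OF p i] laplacian_entry_sum[OF fin, of "xs ! p i" w "xs ! i"]
        by (simp add: reduced_laplacian_def n_def[symmetric] idx)
    qed simp
    also have "\<dots> = (\<Prod>x\<in>U. \<Sum>t\<in>V. ?g x t)"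
      using prod.reindex_bij_betw[OF bij, of "\<lambda>x. \<Sum>t\<in>V. ?g x t"] by simp
    also have "\<dots> = (\<Sum>\<phi>\<in>PiE U (\<lambda>_. V). \<Prod>x\<in>U. ?g x (\<phi> x))"
      using fin by (intro prod_sum_PiE) (auto simp: U_def)
    also have "\<dots> = (\<Sum>\<phi>\<in>PiE U (\<lambda>_. V). (\<Prod>x\<in>U. w x (\<phi> x)) * (\<Prod>i=0..<n. ?e \<phi> p i))"
    proof (rule sum.cong)
      fix \<phi>
      have "(\<Prod>x\<in>U. of_bool (x = xs ! p (idx x)) - of_bool (\<phi> x = xs ! p (idx x)))
          = (\<Prod>i=0..<n. ?e \<phi> p i)"
        using prod.reindex_bij_betw[OF bij,
            of "\<lambda>x. of_bool (x = xs ! p (idx x)) - of_bool (\<phi> x = xs ! p (idx x)) :: real"]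
        by (simp add: idx)
      then show "(\<Prod>x\<in>U. ?g x (\<phi> x)) = (\<Prod>x\<in>U. w x (\<phi> x)) * (\<Prod>i=0..<n. ?e \<phi> p i)"
        by (simp add: prod.distrib)
    qed simp
    finally show ?thesis .
  qed
  have "Determinant.det (reduced_laplacian w V xs)
      = (\<Sum>p\<in>{p. p permutes {0..<n}}. signof p *
          (\<Sum>\<phi>\<in>PiE U (\<lambda>_. V). (\<Prod>x\<in>U. w x (\<phi> x)) * (\<Prod>i=0..<n. ?e \<phi> p i)))"
    unfolding det_def'[OF A] by (intro sum.cong refl arg_cong2[where f = "(*)"]) (simp add: expand)
  also have "\<dots> = (\<Sum>\<phi>\<in>PiE U (\<lambda>_. V). (\<Prod>x\<in>U. w x (\<phi> x)) *
      (\<Sum>p\<in>{p. p permutes {0..<n}}. signof p * (\<Prod>i=0..<n. ?e \<phi> p i)))"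
    unfolding sum_distrib_left by (subst sum.swap) (simp add: mult_ac)
  also have "\<dots> = (\<Sum>\<phi>\<in>PiE U (\<lambda>_. V). (\<Prod>x\<in>U. w x (\<phi> x)) * Determinant.det (pointer_mat xs \<phi>))"
    unfolding det_def'[OF B]
    by (intro sum.cong refl arg_cong2[where f = "(*)"] prod.cong)
       (auto simp: pointer_mat_def n_def[symmetric] pi_n)
  also have "\<dots> = (\<Sum>\<phi>\<in>PiE U (\<lambda>_. V). if acyclic_map \<phi> U then \<Prod>x\<in>U. w x (\<phi> x) else 0)"
    using det_pointer_mat_acyclic[OF xs] det_pointer_mat_cyclic[OF xs]
    by (intro sum.cong) (auto simp: U_def)
  also have "\<dots> = forest_sum w (\<lambda>_. V) U"
    unfolding forest_sum_def forests_def using fin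
    by (subst sum.inter_filter[symmetric]) (auto simp: U_def intro!: finite_PiE)
  finally show ?thesis by (simp add: U_def)
qed

lemma laplacian_entry_row_sum:
  assumes "finite V" "a \<in> V"
  shows "(\<Sum>b\<in>V. laplacian_entry w V a b) = 0"
proof -
  have "(\<Sum>b\<in>V. laplacian_entry w V a b)
      = laplacian_entry w V a a + (\<Sum>b\<in>V - {a}. laplacian_entry w V a b)"
    using assms by (intro sum.remove)
  also have "(\<Sum>b\<in>V - {a}. laplacian_entry w V a b) = (\<Sum>b\<in>V - {a}. - w a b)"
    by (intro sum.cong) (auto simp: laplacian_entry_def)
  finally show ?thesis by (simp add: laplacian_entry_def sum_negf)
qed

text \<open>Since rows and columns of the full Laplacian sum to zero, the congruence by the involution
  \<open>T\<close> below exchanges the roles of the removed vertices \<open>u\<close> and \<open>v\<close>.\<close>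

lemma det_reduced_laplacian_change_root:
  assumes dist: "distinct (u # v # ys)" and V: "V = set (u # v # ys)"
    and sym: "\<And>i j. w i j = w j i"
  shows "Determinant.det (reduced_laplacian w V (u # ys))
       = Determinant.det (reduced_laplacian w V (v # ys))"
proof -
  define n where "n = length (u # ys)"
  define L where "L = laplacian_entry w V"
  \<comment> \<open>Multiplication by \<open>T\<close> on the right replaces the first column by
    minus the sum of all columns and keeps the others. As the rows of the full Laplacian sum to
    zero, this turns the column of \<open>u\<close> into that of \<open>v\<close>.\<close>
  define T :: "real mat" where "T = mat n n (\<lambda>(i, j). if j = 0 then -1 else of_bool (i = j))"
  define M where "M = mat n n (\<lambda>(i, j). L ((u # ys) ! i) ((v # ys) ! j))"
  have Lsym: "L a b = L b a" for a b by (auto simp: L_def laplacian_entry_def sym)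
  have finV: "finite V" by (simp add: V)
  have list_sum: "(\<Sum>k=0..<n. g ((x # ys) ! k)) = sum g (set (x # ys))"
    if "x \<notin> set ys" for x and g :: "'a \<Rightarrow> real"
    using sum.reindex_bij_betw[OF bij_betw_nth[of "x # ys", OF _ refl refl], of g] that dist
    by (simp add: n_def lessThan_atLeast0)
  have row: "(\<Sum>k=0..<n. L a ((u # ys) ! k)) = - L a v" if "a \<in> V" for a
  proof -
    have "sum (L a) V = 0" unfolding L_def by (rule laplacian_entry_row_sum[OF finV that])
    moreover have "V = insert v (set (u # ys))" "v \<notin> set (u # ys)" using V dist by auto
    ultimately show ?thesis using list_sum[of u "L a"] dist by simp
  qed
  have memu: "(u # ys) ! i \<in> V" if "i < n" for i
    using nth_mem[of i "u # ys"] that V by (auto simp: n_def)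
  have memv: "(v # ys) ! i \<in> V" if "i < n" for i
    using nth_mem[of i "v # ys"] that V by (auto simp: n_def)
  have cT: "T \<in> carrier_mat n n" and cM: "M \<in> carrier_mat n n" by (simp_all add: T_def M_def)
  have cR: "reduced_laplacian w V (u # ys) \<in> carrier_mat n n"
    "reduced_laplacian w V (v # ys) \<in> carrier_mat n n"
    by (simp_all add: reduced_laplacian_def n_def)
  have mult_T: "(A * T) $$ (i, j) = (if j = 0 then - (\<Sum>k=0..<n. A $$ (i, k)) else A $$ (i, j))"
    if "A \<in> carrier_mat n n" "i < n" "j < n" for A i j
    using that by (auto simp: T_def scalar_prod_def row_def col_def sum_negf)
  have RT: "reduced_laplacian w V (u # ys) * T = M"
  proof (rule eq_matI)
    fix i j assume "i < dim_row M" "j < dim_col M"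
    then have ij: "i < n" "j < n" by (simp_all add: M_def)
    have "(\<Sum>k=0..<n. reduced_laplacian w V (u # ys) $$ (i, k)) = - L ((u # ys) ! i) v"
      using row[OF memu[OF ij(1)]] ij by (simp add: reduced_laplacian_def L_def n_def)
    then show "(reduced_laplacian w V (u # ys) * T) $$ (i, j) = M $$ (i, j)"
      unfolding mult_T[OF cR(1) ij] using ij
      by (cases j) (auto simp: M_def reduced_laplacian_def L_def n_def)
  qed (use cR cT cM in auto)
  \<comment> \<open>\<open>M\<close> has rows \<open>u # ys\<close> and columns
    \<open>v # ys\<close>. By symmetry of the Laplacian the same operation on its transpose
    exchanges the remaining label.\<close>
  have MT: "transpose_mat M * T = transpose_mat (reduced_laplacian w V (v # ys))"
  proof (rule eq_matI)
    fix i j assume "i < dim_row (transpose_mat (reduced_laplacian w V (v # ys)))"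
      "j < dim_col (transpose_mat (reduced_laplacian w V (v # ys)))"
    then have ij: "i < n" "j < n" by (simp_all add: reduced_laplacian_def n_def)
    have cMt: "transpose_mat M \<in> carrier_mat n n" using cM by simp
    have "(\<Sum>k=0..<n. transpose_mat M $$ (i, k)) = - L ((v # ys) ! i) v"
      using row[OF memv[OF ij(1)]] ij by (simp add: M_def Lsym)
    then show "(transpose_mat M * T) $$ (i, j)
        = transpose_mat (reduced_laplacian w V (v # ys)) $$ (i, j)"
      unfolding mult_T[OF cMt ij] using ij
      by (cases j) (auto simp: M_def reduced_laplacian_def L_def[symmetric] Lsym n_def)
  qed (use cR cT cM in auto)
  have "T * T = 1\<^sub>m n"
  proof (rule eq_matI)
    fix i j assume "i < dim_row (1\<^sub>m n :: real mat)" "j < dim_col (1\<^sub>m n :: real mat)"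
    then have ij: "i < n" "j < n" by simp_all
    have "(\<Sum>k=0..<n. T $$ (i, k)) = (\<Sum>k\<in>insert 0 {1..<n}. if k = 0 then -1 else of_bool (i = k))"
      using ij by (intro sum.cong) (auto simp: T_def)
    also have "\<dots> = - 1 + (\<Sum>k\<in>{1..<n}. if i = k then 1 else 0)"
      by (subst sum.insert) (auto intro!: sum.cong)
    also have "\<dots> = - of_bool (i = 0)" using ij by auto
    finally show "(T * T) $$ (i, j) = 1\<^sub>m n $$ (i, j)"
      unfolding mult_T[OF cT ij] using ij by (auto simp: T_def)
  qed (use cT in auto)
  then have detT: "Determinant.det T * Determinant.det T = 1"
    using det_mult[OF cT cT] by simp
  have "Determinant.det (reduced_laplacian w V (v # ys)) = Determinant.det (transpose_mat M * T)"
    unfolding MT by (rule det_transpose[OF cR(2), symmetric])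
  also have "\<dots> = Determinant.det M * Determinant.det T"
    using det_mult[of "transpose_mat M" n T] det_transpose[OF cM] cM cT by simp
  also have "\<dots> = Determinant.det (reduced_laplacian w V (u # ys)) *
      (Determinant.det T * Determinant.det T)"
    unfolding RT[symmetric] using det_mult[OF cR(1) cT] by simp
  finally show ?thesis by (simp add: detT)
qed

text \<open>For symmetric weights, moving the root reverses the path between the two roots without
  changing the product. The proof works with the determinants instead of reversing paths in parent
  maps.\<close>

lemma forest_sum_root_independent:
  assumes fin: "finite V" and uv: "u \<in> V" "v \<in> V" and sym: "\<And>i j. w i j = w j i"
  shows "forest_sum w (\<lambda>_. V) (V - {u}) = forest_sum w (\<lambda>_. V) (V - {v})"
proof (cases "u = v")
  case False
  obtain ys where ys: "set ys = V - {u, v}" "distinct ys"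
    using finite_distinct_list[of "V - {u, v}"] fin by blast
  have d1: "distinct (v # u # ys)" using ys False by simp
  have d2: "V = set (v # u # ys)" using ys(1) uv by auto
  have "V - {u} = set (v # ys)" "V - {v} = set (u # ys)" using ys(1) uv False by auto
  moreover have "Determinant.det (reduced_laplacian w V (v # ys)) = forest_sum w (\<lambda>_. V) (set (v # ys))"
    "Determinant.det (reduced_laplacian w V (u # ys)) = forest_sum w (\<lambda>_. V) (set (u # ys))"
    using d1 ys(1) uv by (intro det_reduced_laplacian fin; auto)+
  moreover have "Determinant.det (reduced_laplacian w V (v # ys))
      = Determinant.det (reduced_laplacian w V (u # ys))"
    by (rule det_reduced_laplacian_change_root[OF d1 d2]) (rule sym)
  ultimately show ?thesis by metis
qed simp

text \<open>The minor removes the least vertex of \<open>V\<close>; root independence replaces it by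
  any vertex.\<close>

lemma laplacian_minor_forest_sum:
  assumes fin: "finite V" and v: "v \<in> V" and sym: "\<And>i j. f i j = f j i"
  shows "laplacian_minor f V = forest_sum f (\<lambda>_. V) (V - {v})"
proof -
  define vs where "vs = sorted_list_of_set V"
  have vs: "distinct vs" "set vs = V" "length vs = card V" using fin by (auto simp: vs_def)
  obtain x xs where xs: "vs = x # xs" using vs v by (metis empty_iff empty_set neq_Nil_conv)
  have "mat_delete (laplacian f V) 0 0 = reduced_laplacian f V xs"
  proof (rule eq_matI)
    fix i j assume "i < dim_row (reduced_laplacian f V xs)" "j < dim_col (reduced_laplacian f V xs)"
    then have ij: "i < length xs" "j < length xs" by (simp_all add: reduced_laplacian_def)
    moreover have "xs ! i = xs ! j \<longleftrightarrow> i = j"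
      using ij vs(1) xs by (simp add: nth_eq_iff_index_eq)
    ultimately show "mat_delete (laplacian f V) 0 0 $$ (i, j) = reduced_laplacian f V xs $$ (i, j)"
      using vs(3) xs
      by (auto simp: laplacian_def mat_delete_def reduced_laplacian_def laplacian_entry_def
          Let_def vs_def[symmetric])
  qed (use vs(3) xs in \<open>auto simp: laplacian_def mat_delete_def reduced_laplacian_def Let_def\<close>)
  then have "laplacian_minor f V = Determinant.det (reduced_laplacian f V xs)"
    by (simp add: laplacian_minor_def)
  also have "\<dots> = forest_sum f (\<lambda>_. V) (set xs)"
    using vs xs fin by (intro det_reduced_laplacian) auto
  also have "set xs = V - {x}" using vs xs by auto
  also have "forest_sum f (\<lambda>_. V) (V - {x}) = forest_sum f (\<lambda>_. V) (V - {v})"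
    using vs xs fin v by (intro forest_sum_root_independent sym) auto
  finally show ?thesis .
qed

section \<open>Forests with crossing edges\<close>

text \<open>A closed set containing \<open>j\<close> would contain \<open>\<rho>\<close>, which lies
  outside \<open>insert j U\<close>.\<close>

lemma acyclic_map_attach:
  assumes ac: "acyclic_map \<phi> U" and "\<rho> \<notin> U" "\<rho> \<noteq> j"
  shows "acyclic_map (\<phi>(j := \<rho>)) (insert j U)"
  unfolding acyclic_map_def
proof (intro allI impI)
  fix N assume N: "N \<subseteq> insert j U" "\<phi>(j := \<rho>) ` N \<subseteq> N"
  then have "j \<notin> N" using assms by (auto dest!: image_subset_iff[THEN iffD1])
  then show "N = {}" using N by (intro acyclic_mapD[OF ac]) auto
qed

text \<open>The root \<open>j\<close> is hung under another root \<open>\<rho>\<close>. No forest is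
  lost, since a map on \<open>U\<close> has the fixed value \<open>undefined\<close> at
  \<open>j\<close>, and each product gains the factor \<open>f j \<rho>\<close>.\<close>

lemma forest_sum_attach_root:
  assumes fin: "finite U" "finite V" and j: "j \<notin> U" and \<rho>: "\<rho> \<in> V" "\<rho> \<notin> U" "\<rho> \<noteq> j"
    and f0: "\<And>i t. 0 \<le> f i t" and m: "m \<le> f j \<rho>"
  shows "m * forest_sum f (\<lambda>_. V) U \<le> forest_sum f (\<lambda>_. V) (insert j U)"
proof -
  let ?g = "\<lambda>\<phi> :: 'a \<Rightarrow> 'a. \<phi>(j := \<rho>)"
  have inj: "inj_on ?g (forests (\<lambda>_. V) U)"
  proof (rule inj_onI)
    fix \<phi> \<psi> assume "\<phi> \<in> forests (\<lambda>_. V) U" "\<psi> \<in> forests (\<lambda>_. V) U" and eq: "?g \<phi> = ?g \<psi>"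
    then have "\<phi> j = \<psi> j" using j by (auto simp: forests_def PiE_def extensional_def)
    then show "\<phi> = \<psi>" using eq by (metis fun_upd_triv fun_upd_upd)
  qed
  have im: "?g ` forests (\<lambda>_. V) U \<subseteq> forests (\<lambda>_. V) (insert j U)"
    using \<rho> by (auto simp: forests_def PiE_def extensional_def intro!: acyclic_map_attach)
  have "m * forest_sum f (\<lambda>_. V) U = (\<Sum>\<phi>\<in>forests (\<lambda>_. V) U. m * (\<Prod>i\<in>U. f i (\<phi> i)))"
    by (simp add: forest_sum_def sum_distrib_left)
  also have "\<dots> \<le> (\<Sum>\<phi>\<in>forests (\<lambda>_. V) U. f j \<rho> * (\<Prod>i\<in>U. f i (\<phi> i)))"
    using m f0 by (intro sum_mono mult_right_mono prod_nonneg) auto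
  also have "\<dots> = (\<Sum>\<phi>\<in>forests (\<lambda>_. V) U. \<Prod>i\<in>insert j U. f i (?g \<phi> i))"
  proof (rule sum.cong)
    fix \<phi>
    have "(\<Prod>i\<in>U. f i (?g \<phi> i)) = (\<Prod>i\<in>U. f i (\<phi> i))" using j by (intro prod.cong) auto
    then show "f j \<rho> * (\<Prod>i\<in>U. f i (\<phi> i)) = (\<Prod>i\<in>insert j U. f i (?g \<phi> i))"
      using fin j by simp
  qed simp
  also have "\<dots> = (\<Sum>\<phi>\<in>?g ` forests (\<lambda>_. V) U. \<Prod>i\<in>insert j U. f i (\<phi> i))"
    by (simp add: sum.reindex[OF inj])
  also have "\<dots> \<le> forest_sum f (\<lambda>_. V) (insert j U)"
    unfolding forest_sum_def
    using fin by (intro sum_mono2[OF finite_forests im]) (auto intro!: prod_nonneg f0)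
  finally show ?thesis .
qed

text \<open>Without a root, \<open>V\<close> itself is closed under the parent map. This is the case
  of a cluster that receives no root.\<close>

lemma forest_sum_whole: "V \<noteq> {} \<Longrightarrow> forest_sum f (\<lambda>_. V) V = 0"
  unfolding forest_sum_def forests_def
  by (rule sum.neutral) (auto simp: acyclic_map_def dest!: spec[of _ V])

text \<open>All roots but one are attached to a remaining root, each time for a factor
  \<open>m\<close>, and root independence finally moves the last root to \<open>v\<close>. The extra
  \<open>m\<close> on the right makes the exponent \<open>card R\<close> instead of
  \<open>card R - 1\<close>, so that \<open>R = {}\<close> is included and exponents add up over
  clusters.\<close>

lemma forest_sum_roots_le:
  assumes fin: "finite V" and v: "v \<in> V" and R: "R \<subseteq> V"
    and sym: "\<And>i j. f i j = f j i" and f0: "\<And>i j. 0 \<le> f i j" and m0: "0 \<le> m"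
    and m: "\<And>i j. i \<in> V \<Longrightarrow> j \<in> V \<Longrightarrow> i \<noteq> j \<Longrightarrow> m \<le> f i j"
  shows "m ^ card R * forest_sum f (\<lambda>_. V) (V - R) \<le> m * forest_sum f (\<lambda>_. V) (V - {v})"
proof (cases "R = {}")
  case True
  have "V \<noteq> {}" using v by auto
  then show ?thesis using True m0 f0 by (auto simp: forest_sum_whole intro!: mult_nonneg_nonneg forest_sum_nonneg)
next
  case False
  have "finite R" using R fin finite_subset by blast
  then show ?thesis using False R
  proof (induction R rule: finite_ne_induct)
    case (singleton u)
    then show ?case using forest_sum_root_independent[where w = f, OF fin _ v sym, of u] by simp
  next
    case (insert x F)
    obtain \<rho> where \<rho>: "\<rho> \<in> F" using insert.hyps by auto
    have *: "insert x (V - insert x F) = V - F" using insert by auto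
    have "m * forest_sum f (\<lambda>_. V) (V - insert x F) \<le> forest_sum f (\<lambda>_. V) (V - F)"
      unfolding *[symmetric] using insert \<rho> fin
      by (intro forest_sum_attach_root[where \<rho> = \<rho>]) (auto intro!: f0 m)
    then have "m ^ card F * (m * forest_sum f (\<lambda>_. V) (V - insert x F))
        \<le> m ^ card F * forest_sum f (\<lambda>_. V) (V - F)"
      using m0 by (intro mult_left_mono) auto
    also have "\<dots> \<le> m * forest_sum f (\<lambda>_. V) (V - {v})" using insert by auto
    finally show ?case using insert.hyps by (simp add: mult_ac)
  qed
qed

section \<open>Factorization of forest sums over disjoint vertex sets\<close>

lemma forest_sum_empty [simp]: "forest_sum w T {} = 1"
proof -
  have "forests T {} = {\<lambda>_. undefined}" by (auto simp: forests_def acyclic_map_def)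
  then show ?thesis by (simp add: forest_sum_def)
qed

lemma forest_sum_cong:
  assumes "\<And>i. i \<in> U \<Longrightarrow> T i = T' i"
  shows "forest_sum w T U = forest_sum w T' U"
  unfolding forest_sum_def forests_def using PiE_cong[of U T T'] assms by simp

text \<open>Parents never leave their own side, so a closed subset of the union meets
  \<open>U1\<close> and \<open>U2\<close> in closed sets. The sets \<open>B1\<close> and
  \<open>B2\<close> are larger than \<open>U1\<close> and \<open>U2\<close> in order to contain the
  roots.\<close>

lemma forest_sum_Un:
  assumes fin: "finite U1" "finite U2" and B: "B1 \<inter> B2 = {}" "U1 \<subseteq> B1" "U2 \<subseteq> B2"
    and T: "\<And>i. i \<in> U1 \<Longrightarrow> T i \<subseteq> B1" "\<And>i. i \<in> U2 \<Longrightarrow> T i \<subseteq> B2"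
  shows "forest_sum w T (U1 \<union> U2) = forest_sum w T U1 * forest_sum w T U2"
proof -
  have dis: "U1 \<inter> U2 = {}" using B by auto
  let ?join = "\<lambda>(\<phi>, \<psi>) j. if j \<in> U1 then \<phi> j else \<psi> j"
  let ?split = "\<lambda>\<phi>. (restrict \<phi> U1, restrict \<phi> U2)"
  have "forest_sum w T (U1 \<union> U2)
      = (\<Sum>(\<phi>, \<psi>)\<in>forests T U1 \<times> forests T U2. (\<Prod>i\<in>U1. w i (\<phi> i)) * (\<Prod>i\<in>U2. w i (\<psi> i)))"
    unfolding forest_sum_def
  proof (rule sum.reindex_bij_witness[of _ ?join ?split])
    fix \<phi> assume \<phi>: "\<phi> \<in> forests T (U1 \<union> U2)"
    then show "?join (?split \<phi>) = \<phi>"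
      by (auto simp: forests_def PiE_def extensional_def fun_eq_iff)
    have "acyclic_map \<phi> U1" "acyclic_map \<phi> U2"
      using \<phi> by (auto simp: forests_def intro: acyclic_map_subset)
    then have "acyclic_map (restrict \<phi> U1) U1" "acyclic_map (restrict \<phi> U2) U2"
      by (auto elim: acyclic_map_cong)
    then show "?split \<phi> \<in> forests T U1 \<times> forests T U2"
      using \<phi> by (auto simp: forests_def)
    have "(\<Prod>i\<in>U1 \<union> U2. w i (\<phi> i)) = (\<Prod>i\<in>U1. w i (\<phi> i)) * (\<Prod>i\<in>U2. w i (\<phi> i))"
      by (rule prod.union_disjoint[OF fin dis])
    then show "(case ?split \<phi> of (\<phi>, \<psi>) \<Rightarrow> (\<Prod>i\<in>U1. w i (\<phi> i)) * (\<Prod>i\<in>U2. w i (\<psi> i)))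
        = (\<Prod>i\<in>U1 \<union> U2. w i (\<phi> i))" by simp
  next
    fix p assume p: "p \<in> forests T U1 \<times> forests T U2"
    obtain \<phi> \<psi> where p_eq: "p = (\<phi>, \<psi>)" by (cases p)
    have \<phi>: "\<phi> \<in> PiE U1 T" "acyclic_map \<phi> U1" and \<psi>: "\<psi> \<in> PiE U2 T" "acyclic_map \<psi> U2"
      using p by (auto simp: p_eq forests_def)
    show "?split (?join p) = p"
      using \<phi>(1) \<psi>(1) dis by (auto simp: p_eq fun_eq_iff restrict_def PiE_def extensional_def)
    have "acyclic_map (?join p) (U1 \<union> U2)" unfolding acyclic_map_def
    proof (intro allI impI)
      fix N assume N: "N \<subseteq> U1 \<union> U2" "?join p ` N \<subseteq> N"
      have Ncl: "?join p i \<in> N" if "i \<in> N" for i using N(2) that by blast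
      have "N \<inter> U1 = {}"
      proof (rule acyclic_mapD[OF \<phi>(2)])
        fix i assume i: "i \<in> N \<inter> U1"
        then have "\<phi> i \<in> N" using Ncl[of i] by (simp add: p_eq)
        moreover have "\<phi> i \<in> B1" using PiE_mem[OF \<phi>(1), of i] T(1)[of i] i by auto
        ultimately show "\<phi> i \<in> N \<inter> U1" using N(1) B by auto
      qed auto
      moreover have "N \<inter> U2 = {}"
      proof (rule acyclic_mapD[OF \<psi>(2)])
        fix i assume i: "i \<in> N \<inter> U2"
        then have "i \<notin> U1" using dis by auto
        then have "\<psi> i \<in> N" using Ncl[of i] i by (simp add: p_eq)
        moreover have "\<psi> i \<in> B2" using PiE_mem[OF \<psi>(1), of i] T(2)[of i] i by auto
        ultimately show "\<psi> i \<in> N \<inter> U2" using N(1) B by auto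
      qed auto
      ultimately show "N = {}" using N(1) by auto
    qed
    moreover have "?join p \<in> PiE (U1 \<union> U2) T"
      using \<phi>(1) \<psi>(1) dis by (auto simp: p_eq PiE_def extensional_def Pi_def)
    ultimately show "?join p \<in> forests T (U1 \<union> U2)" by (simp add: forests_def)
  qed
  also have "\<dots> = forest_sum w T U1 * forest_sum w T U2"
    unfolding forest_sum_def sum_product sum.cartesian_product ..
  finally show ?thesis .
qed

lemma forest_sum_UN:
  assumes "finite I" "disjoint_family_on B I"
    and "\<And>k. k \<in> I \<Longrightarrow> finite (U k)" "\<And>k. k \<in> I \<Longrightarrow> U k \<subseteq> B k"
    and "\<And>k i. k \<in> I \<Longrightarrow> i \<in> U k \<Longrightarrow> T i \<subseteq> B k"
  shows "forest_sum w T (\<Union>k\<in>I. U k) = (\<Prod>k\<in>I. forest_sum w T (U k))"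
  using assms
proof (induction I rule: finite_induct)
  case (insert k I)
  have "forest_sum w T (U k \<union> (\<Union>k\<in>I. U k)) = forest_sum w T (U k) * forest_sum w T (\<Union>k\<in>I. U k)"
  proof (rule forest_sum_Un)
    show "B k \<inter> (\<Union>k\<in>I. B k) = {}"
      using insert.prems(1) insert.hyps by (auto simp: disjoint_family_on_def)
    show "(\<Union>k\<in>I. U k) \<subseteq> (\<Union>k\<in>I. B k)" using insert.prems(3) by blast
    fix i assume "i \<in> (\<Union>k\<in>I. U k)"
    then show "T i \<subseteq> (\<Union>k\<in>I. B k)" using insert.prems(4) by blast
  qed (use insert in auto)
  also have "forest_sum w T (\<Union>k\<in>I. U k) = (\<Prod>k\<in>I. forest_sum w T (U k))"
    using insert.prems by (intro insert.IH) (auto simp: disjoint_family_on_def)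
  finally show ?case using insert.hyps by simp
qed simp

text \<open>Cutting the crossing edges of a forest leaves a forest inside the clusters, whose roots
  are the old roots and the tails of the cut edges.\<close>

lemma crossing_forests_le:
  fixes cl :: "'a \<Rightarrow> 'b"
  assumes fin: "finite V" and U: "U \<subseteq> V" and f0: "\<And>i j. 0 \<le> f i j" and q0: "0 \<le> q"
    and q: "\<And>i j. i \<in> V \<Longrightarrow> j \<in> V \<Longrightarrow> cl i \<noteq> cl j \<Longrightarrow> f i j \<le> q"
  shows "(\<Sum>\<phi>\<in>{\<phi> \<in> forests (\<lambda>_. V) U. \<exists>i\<in>U. cl (\<phi> i) \<noteq> cl i}. \<Prod>i\<in>U. f i (\<phi> i))
    \<le> (\<Sum>X\<in>Pow U - {{}}. (real (card V) * q) ^ card X *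
          forest_sum f (\<lambda>i. {j \<in> V. cl j = cl i}) (U - X))"
proof -
  define T where "T = (\<lambda>i. {j \<in> V. cl j = cl i})"
  define S where "S = {\<phi> \<in> forests (\<lambda>_. V) U. \<exists>i\<in>U. cl (\<phi> i) \<noteq> cl i}"
  define X where "X = (\<lambda>\<phi>. {i \<in> U. cl (\<phi> i) \<noteq> cl i})"
  have finU: "finite U" using U fin finite_subset by blast
  have finS: "finite S" unfolding S_def using finite_forests[OF finU, of "\<lambda>_. V"] fin by auto
  have finT: "finite (T i)" for i using fin by (simp add: T_def)
  have "(\<Sum>\<phi>\<in>S. \<Prod>i\<in>U. f i (\<phi> i))
      = (\<Sum>Y\<in>Pow U - {{}}. \<Sum>\<phi>\<in>{\<phi> \<in> S. X \<phi> = Y}. \<Prod>i\<in>U. f i (\<phi> i))"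
    using finS finU by (intro sum.group[symmetric]) (auto simp: S_def X_def)
  also have "\<dots> \<le> (\<Sum>Y\<in>Pow U - {{}}. (real (card V) * q) ^ card Y * forest_sum f T (U - Y))"
  proof (rule sum_mono)
    fix Y assume "Y \<in> Pow U - {{}}"
    then have Y: "Y \<subseteq> U" by auto
    have finY: "finite Y" "finite (U - Y)" using Y finU finite_subset by auto
    \<comment> \<open>The heads of the cut edges are remembered only as arbitrary elements of
      \<open>V\<close>, which costs a factor \<open>card V\<close> per edge. What remains is a
      forest inside the clusters.\<close>
    let ?P = "PiE Y (\<lambda>_. V) \<times> forests T (U - Y)"
    let ?join = "\<lambda>(\<psi>, \<eta>) j. if j \<in> Y then \<psi> j else \<eta> j"
    have "(\<Sum>\<phi>\<in>{\<phi> \<in> S. X \<phi> = Y}. \<Prod>i\<in>U. f i (\<phi> i))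
        \<le> (\<Sum>(\<psi>, \<eta>)\<in>?P. q ^ card Y * (\<Prod>i\<in>U - Y. f i (\<eta> i)))"
    proof (rule sum_le_included[where i = ?join])
      show "finite {\<phi> \<in> S. X \<phi> = Y}" using finS by simp
      show "finite ?P" using finY fin finT by (intro finite_cartesian_product finite_PiE finite_forests) auto
      show "\<forall>p\<in>?P. 0 \<le> (case p of (\<psi>, \<eta>) \<Rightarrow> q ^ card Y * (\<Prod>i\<in>U - Y. f i (\<eta> i)))"
        using q0 f0 by (auto intro!: mult_nonneg_nonneg prod_nonneg)
      show "\<forall>\<phi>\<in>{\<phi> \<in> S. X \<phi> = Y}. \<exists>p\<in>?P. ?join p = \<phi> \<and> (\<Prod>i\<in>U. f i (\<phi> i))
          \<le> (case p of (\<psi>, \<eta>) \<Rightarrow> q ^ card Y * (\<Prod>i\<in>U - Y. f i (\<eta> i)))"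
      proof
        fix \<phi> assume "\<phi> \<in> {\<phi> \<in> S. X \<phi> = Y}"
        then have \<phi>: "\<phi> \<in> PiE U (\<lambda>_. V)" "acyclic_map \<phi> U" and XY: "X \<phi> = Y"
          by (auto simp: S_def forests_def)
        have mem: "\<phi> i \<in> V" if "i \<in> U" for i using \<phi>(1) that by (rule PiE_mem)
        let ?p = "(restrict \<phi> Y, restrict \<phi> (U - Y))"
        have "acyclic_map (restrict \<phi> (U - Y)) (U - Y)"
          using acyclic_map_subset[OF \<phi>(2), of "U - Y"] by (auto elim: acyclic_map_cong)
        moreover have "cl (\<phi> i) = cl i" if "i \<in> U - Y" for i using that XY by (auto simp: X_def)
        ultimately have "?p \<in> ?P" using mem Y by (auto simp: forests_def T_def)
        moreover have "?join ?p = \<phi>"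
          using \<phi>(1) Y by (auto simp: PiE_def extensional_def fun_eq_iff)
        moreover have "(\<Prod>i\<in>U. f i (\<phi> i)) \<le> q ^ card Y * (\<Prod>i\<in>U - Y. f i (\<phi> i))"
        proof -
          have "(\<Prod>i\<in>U. f i (\<phi> i)) = (\<Prod>i\<in>Y. f i (\<phi> i)) * (\<Prod>i\<in>U - Y. f i (\<phi> i))"
            using prod.subset_diff[OF Y finU, of "\<lambda>i. f i (\<phi> i)"] by (simp add: mult.commute)
          also have "(\<Prod>i\<in>Y. f i (\<phi> i)) \<le> (\<Prod>i\<in>Y. q)"
          proof (rule prod_mono)
            fix i assume "i \<in> Y"
            then have "i \<in> V" "\<phi> i \<in> V" "cl i \<noteq> cl (\<phi> i)" using XY mem U by (auto simp: X_def)
            then show "0 \<le> f i (\<phi> i) \<and> f i (\<phi> i) \<le> q" using q f0 by auto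
          qed
          finally show ?thesis using f0 by (simp add: mult_right_mono prod_nonneg)
        qed
        ultimately show "\<exists>p\<in>?P. ?join p = \<phi> \<and> (\<Prod>i\<in>U. f i (\<phi> i))
            \<le> (case p of (\<psi>, \<eta>) \<Rightarrow> q ^ card Y * (\<Prod>i\<in>U - Y. f i (\<eta> i)))"
          by (intro bexI[of _ ?p] conjI) simp_all
      qed
    qed
    also have "\<dots> = real (card V) ^ card Y * (q ^ card Y * forest_sum f T (U - Y))"
      using finY by (simp add: sum.cartesian_product[symmetric] forest_sum_def sum_distrib_left card_PiE)
    finally show "(\<Sum>\<phi>\<in>{\<phi> \<in> S. X \<phi> = Y}. \<Prod>i\<in>U. f i (\<phi> i))
        \<le> (real (card V) * q) ^ card Y * forest_sum f T (U - Y)"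
      by (simp add: power_mult_distrib mult_ac)
  qed
  finally show ?thesis by (simp add: S_def T_def)
qed

lemma sum_Pow_power:
  fixes y :: real
  assumes "finite U"
  shows "(\<Sum>X\<in>Pow U. y ^ card X) = (1 + y) ^ card U"
  using prod_add[OF assms, of "\<lambda>_. y" "\<lambda>_. 1"] by (simp add: add.commute)

text \<open>For each cut set \<open>X\<close> the inequalities of the clusters multiply to
  \<open>m ^ (card R + card X)\<close> times the forest sum being at most \<open>m ^ card R\<close>
  times the product of the \<open>\<tau> l\<close>; the hypothesis on \<open>card R\<close> is what
  makes the powers cancel down to \<open>m ^ card X\<close>. The crossing edges supply
  \<open>(card V * \<epsilon> * m) ^ card X\<close>, and summing over nonempty \<open>X\<close> is
  the binomial theorem without its constant term.\<close>

lemma crossing_forests_bound: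
  fixes cl :: "'a \<Rightarrow> 'b"
  assumes fin: "finite V" and R: "R \<subseteq> V" and cardR: "card R = card (cl ` V)"
    and sym: "\<And>i j. f i j = f j i" and f0: "\<And>i j. 0 \<le> f i j"
    and m: "0 < m" and \<epsilon>: "0 \<le> \<epsilon>"
    and within: "\<And>i j. i \<in> V \<Longrightarrow> j \<in> V \<Longrightarrow> i \<noteq> j \<Longrightarrow> cl i = cl j \<Longrightarrow> m \<le> f i j"
    and between: "\<And>i j. i \<in> V \<Longrightarrow> j \<in> V \<Longrightarrow> cl i \<noteq> cl j \<Longrightarrow> f i j \<le> \<epsilon> * m"
    and \<tau>: "\<And>l. l \<in> cl ` V \<Longrightarrow> \<exists>v\<in>V. cl v = l \<and>
      \<tau> l = forest_sum f (\<lambda>_. {i \<in> V. cl i = l}) ({i \<in> V. cl i = l} - {v})"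
  shows "(\<Sum>\<phi>\<in>{\<phi> \<in> forests (\<lambda>_. V) (V - R). \<exists>i\<in>V - R. cl (\<phi> i) \<noteq> cl i}. \<Prod>i\<in>V - R. f i (\<phi> i))
    \<le> ((1 + real (card V) * \<epsilon>) ^ card V - 1) * (\<Prod>l\<in>cl ` V. \<tau> l)"
proof -
  define B where "B = (\<lambda>l. {i \<in> V. cl i = l})"
  define T where "T = (\<lambda>i. {j \<in> V. cl j = cl i})"
  define y where "y = real (card V) * \<epsilon>"
  let ?\<Pi> = "\<Prod>l\<in>cl ` V. \<tau> l"
  have y0: "0 \<le> y" using \<epsilon> by (simp add: y_def)
  have \<tau>0: "0 \<le> \<tau> l" if l: "l \<in> cl ` V" for l using \<tau>[OF l] f0 by (auto intro!: forest_sum_nonneg)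
  have finB: "finite (B l)" for l using fin by (simp add: B_def)
  have le: "m ^ card X * forest_sum f T (V - R - X) \<le> ?\<Pi>" if X: "X \<subseteq> V - R" for X
  proof -
    \<comment> \<open>\<open>Q\<close> is the set of all roots after cutting the edges with tails in
      \<open>X\<close>.\<close>
    define Q where "Q = R \<union> X"
    have Q: "Q \<subseteq> V" "finite Q" using R X fin by (auto simp: Q_def intro: finite_subset)
    have finX: "finite X" "finite R" using Q by (auto simp: Q_def)
    have cardQ: "card Q = card R + card X"
      unfolding Q_def using finX X by (intro card_Un_disjoint) auto
    have "V - R - X = (\<Union>l\<in>cl ` V. B l - Q)" by (auto simp: B_def Q_def)
    moreover have "forest_sum f T (\<Union>l\<in>cl ` V. B l - Q) = (\<Prod>l\<in>cl ` V. forest_sum f T (B l - Q))"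
      using fin by (intro forest_sum_UN[where B = B]) (auto simp: B_def T_def disjoint_family_on_def)
    moreover have "forest_sum f T (B l - Q) = forest_sum f (\<lambda>_. B l) (B l - (Q \<inter> B l))" for l
    proof -
      have "B l - Q = B l - (Q \<inter> B l)" by auto
      then show ?thesis by (simp only:) (rule forest_sum_cong, auto simp: T_def B_def)
    qed
    ultimately have split: "forest_sum f T (V - R - X)
        = (\<Prod>l\<in>cl ` V. forest_sum f (\<lambda>_. B l) (B l - (Q \<inter> B l)))" by simp
    have "card Q = (\<Sum>l\<in>cl ` V. card (Q \<inter> B l))"
    proof -
      have "Q = (\<Union>l\<in>cl ` V. Q \<inter> B l)" using Q by (auto simp: B_def)
      then have "card Q = card (\<Union>l\<in>cl ` V. Q \<inter> B l)" by simp
      also have "\<dots> = (\<Sum>l\<in>cl ` V. card (Q \<inter> B l))"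
        using fin Q by (intro card_UN_disjoint) (auto simp: B_def)
      finally show ?thesis .
    qed
    then have "m ^ card Q * forest_sum f T (V - R - X)
        = (\<Prod>l\<in>cl ` V. m ^ card (Q \<inter> B l) * forest_sum f (\<lambda>_. B l) (B l - (Q \<inter> B l)))"
      by (simp add: split power_sum prod.distrib)
    also have "\<dots> \<le> (\<Prod>l\<in>cl ` V. m * \<tau> l)"
    proof (rule prod_mono)
      fix l assume l: "l \<in> cl ` V"
      obtain v where v: "v \<in> B l" "\<tau> l = forest_sum f (\<lambda>_. B l) (B l - {v})"
        using \<tau>[OF l] by (auto simp: B_def)
      have "m ^ card (Q \<inter> B l) * forest_sum f (\<lambda>_. B l) (B l - (Q \<inter> B l))
          \<le> m * forest_sum f (\<lambda>_. B l) (B l - {v})"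
        using finB v(1) m by (intro forest_sum_roots_le sym f0 within) (auto simp: B_def)
      then show "0 \<le> m ^ card (Q \<inter> B l) * forest_sum f (\<lambda>_. B l) (B l - (Q \<inter> B l)) \<and>
          m ^ card (Q \<inter> B l) * forest_sum f (\<lambda>_. B l) (B l - (Q \<inter> B l)) \<le> m * \<tau> l"
        using v(2) m f0 by (auto intro!: mult_nonneg_nonneg forest_sum_nonneg)
    qed
    also have "\<dots> = m ^ card R * ?\<Pi>" by (simp add: prod.distrib cardR)
    finally have "m ^ card R * (m ^ card X * forest_sum f T (V - R - X)) \<le> m ^ card R * ?\<Pi>"
      by (simp add: cardQ power_add mult_ac)
    then show ?thesis using m by simp
  qed
  have finU: "finite (V - R)" using fin by simp
  have "(\<Sum>\<phi>\<in>{\<phi> \<in> forests (\<lambda>_. V) (V - R). \<exists>i\<in>V - R. cl (\<phi> i) \<noteq> cl i}. \<Prod>i\<in>V - R. f i (\<phi> i))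
      \<le> (\<Sum>X\<in>Pow (V - R) - {{}}. (real (card V) * (\<epsilon> * m)) ^ card X * forest_sum f T (V - R - X))"
    unfolding T_def using fin m \<epsilon> by (intro crossing_forests_le f0 between) auto
  also have "\<dots> \<le> (\<Sum>X\<in>Pow (V - R) - {{}}. y ^ card X * ?\<Pi>)"
  proof (rule sum_mono)
    fix X assume "X \<in> Pow (V - R) - {{}}"
    then have "y ^ card X * (m ^ card X * forest_sum f T (V - R - X)) \<le> y ^ card X * ?\<Pi>"
      using y0 by (intro mult_left_mono le) auto
    then show "(real (card V) * (\<epsilon> * m)) ^ card X * forest_sum f T (V - R - X) \<le> y ^ card X * ?\<Pi>"
      by (simp add: y_def power_mult_distrib mult_ac)
  qed
  also have "\<dots> = ((1 + y) ^ card (V - R) - 1) * ?\<Pi>"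
  proof -
    have "(\<Sum>X\<in>Pow (V - R) - {{}}. y ^ card X) = (\<Sum>X\<in>Pow (V - R). y ^ card X) - 1"
      using finU by (subst sum_diff) auto
    then show ?thesis using sum_Pow_power[OF finU, of y] by (simp add: sum_distrib_right[symmetric])
  qed
  also have "\<dots> \<le> ((1 + y) ^ card V - 1) * ?\<Pi>"
  proof (intro mult_right_mono diff_right_mono power_increasing)
    show "card (V - R) \<le> card V" using fin by (intro card_mono) auto
  qed (use y0 \<tau>0 in \<open>auto intro!: prod_nonneg\<close>)
  finally show ?thesis by (simp add: y_def)
qed

section \<open>Ordered partitions\<close>

text \<open>Ordered partitions are extensional functions; dropping this lets the oracle blocks,
  which are also defined outside \<open>{1..K}\<close>, be treated alike.\<close>

definition block_family :: "nat \<Rightarrow> nat \<Rightarrow> (nat \<Rightarrow> nat set) \<Rightarrow> bool" where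
  "block_family n K B \<longleftrightarrow>
     (\<forall>k\<in>{1..K}. B k \<noteq> {}) \<and> disjoint_family_on B {1..K} \<and> (\<Union>k\<in>{1..K}. B k) = {1..n}"

lemma ordered_partitions_iff:
  "W \<in> ordered_partitions n K \<longleftrightarrow> W \<in> extensional {1..K} \<and> block_family n K W"
  by (auto simp: ordered_partitions_def block_family_def PiE_def)

lemma label_eq:
  assumes "block_family n K B" "k \<in> {1..K}" "i \<in> B k"
  shows "label K B i = k"
  unfolding label_def
proof (rule the_equality)
  show "k' = k" if "k' \<in> {1..K} \<and> i \<in> B k'" for k'
    using that assms unfolding block_family_def disjoint_family_on_def by blast
qed (use assms in simp)

lemma label_mem:
  assumes "block_family n K B" "i \<in> {1..n}"
  shows "label K B i \<in> {1..K}" "i \<in> B (label K B i)"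
proof -
  obtain k where "k \<in> {1..K}" "i \<in> B k" using assms unfolding block_family_def by blast
  then show "label K B i \<in> {1..K}" "i \<in> B (label K B i)" using label_eq[OF assms(1)] by auto
qed

lemma block_family_subset: "block_family n K B \<Longrightarrow> k \<in> {1..K} \<Longrightarrow> B k \<subseteq> {1..n}"
  by (auto simp: block_family_def)

lemma block_family_finite: "block_family n K B \<Longrightarrow> k \<in> {1..K} \<Longrightarrow> finite (B k)"
  using finite_subset[OF block_family_subset, of n K B k] by simp

lemma block_family_nonempty: "block_family n K B \<Longrightarrow> k \<in> {1..K} \<Longrightarrow> B k \<noteq> {}"
  by (auto simp: block_family_def)

lemma block_family_label_eq:
  assumes "block_family n K B" "k \<in> {1..K}"
  shows "{i \<in> {1..n}. label K B i = k} = B k"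
  using assms label_eq[OF assms(1)] label_mem[OF assms(1)] block_family_subset[OF assms] by auto

lemma block_family_label_image:
  assumes "block_family n K B"
  shows "label K B ` {1..n} = {1..K}"
proof (intro equalityI subsetI)
  fix k assume k: "k \<in> {1..K}"
  then obtain i where "i \<in> B k" using block_family_nonempty[OF assms k] by auto
  then show "k \<in> label K B ` {1..n}"
    using label_eq[OF assms k] block_family_subset[OF assms k] by force
qed (use label_mem[OF assms] in auto)

section \<open>Bounds for the Hamming distance\<close>

lemma hamming_set:
  fixes n K W1 W2
  defines "S \<equiv> {card {i \<in> {1..n}. \<psi> (label K W1 i) \<noteq> label K W2 i} | \<psi>. \<psi> permutes {1..K}}"
  shows "finite S" and "hamming n K W1 W2 = Min S"
proof -
  have "S = (\<lambda>\<psi>. card {i \<in> {1..n}. \<psi> (label K W1 i) \<noteq> label K W2 i}) ` {\<psi>. \<psi> permutes {1..K}}"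
    by (auto simp: S_def)
  then show "finite S" by (simp add: finite_permutations)
qed (simp add: hamming_def S_def)

lemma hamming_le_permutation:
  assumes "\<psi> permutes {1..K}"
  shows "hamming n K W1 W2 \<le> card {i \<in> {1..n}. \<psi> (label K W1 i) \<noteq> label K W2 i}"
  unfolding hamming_set(2) using assms by (intro Min_le hamming_set(1)) auto

lemma hamming_le: "hamming n K W1 W2 \<le> n"
proof -
  have "hamming n K W1 W2 \<le> card {i \<in> {1..n}. id (label K W1 i) \<noteq> label K W2 i}"
    by (rule hamming_le_permutation) (rule permutes_id)
  also have "\<dots> \<le> card {1..n}" by (rule card_mono) auto
  finally show ?thesis by simp
qed

text \<open>Sending a block of \<open>W\<close> to the block of \<open>B\<close> that contains it is
  onto \<open>{1..K}\<close>, as the blocks of \<open>B\<close> are nonempty. Both partitions have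
  \<open>K\<close> blocks, so this map is a relabelling.\<close>

lemma hamming_refinement:
  assumes W: "block_family n K W" and B: "block_family n K B"
    and ref: "\<And>k i j. k \<in> {1..K} \<Longrightarrow> i \<in> W k \<Longrightarrow> j \<in> W k \<Longrightarrow> label K B i = label K B j"
  shows "hamming n K W B = 0"
proof -
  define g where "g = (\<lambda>k. label K B (SOME i. i \<in> W k))"
  have g: "g k = label K B i" if "k \<in> {1..K}" "i \<in> W k" for k i
    using ref[OF that(1) someI[of "\<lambda>i. i \<in> W k", OF that(2)] that(2)] by (simp add: g_def)
  have "{1..K} \<subseteq> g ` {1..K}"
  proof
    fix l assume "l \<in> {1..K}"
    then obtain i where i: "i \<in> {1..n}" "label K B i = l"
      using block_family_label_image[OF B] by (metis imageE)
    then have "g (label K W i) = l" using g label_mem[OF W i(1)] by auto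
    then show "l \<in> g ` {1..K}" using label_mem(1)[OF W i(1)] by auto
  qed
  moreover have "g ` {1..K} \<subseteq> {1..K}"
  proof (rule image_subsetI)
    fix k assume k: "k \<in> {1..K}"
    then obtain i where i: "i \<in> W k" using block_family_nonempty[OF W k] by auto
    then have "i \<in> {1..n}" using block_family_subset[OF W k] by auto
    then show "g k \<in> {1..K}" using g[OF k i] label_mem(1)[OF B] by simp
  qed
  ultimately have im: "g ` {1..K} = {1..K}" by auto
  have "inj_on g {1..K}" by (rule eq_card_imp_inj_on) (simp_all only: im finite_atLeastAtMost)
  then have bij: "bij_betw g {1..K} {1..K}" using im by (simp add: bij_betw_def)
  define \<psi> where "\<psi> = (\<lambda>k. if k \<in> {1..K} then g k else k)"
  have "bij_betw \<psi> {1..K} {1..K}" using bij by (rule bij_betw_cong[THEN iffD1, rotated]) (simp add: \<psi>_def)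
  then have perm: "\<psi> permutes {1..K}" by (rule bij_imp_permutes) (auto simp: \<psi>_def)
  have "{i \<in> {1..n}. \<psi> (label K W i) \<noteq> label K B i} = {}"
    using g label_mem[OF W] by (auto simp: \<psi>_def)
  then show ?thesis using hamming_le_permutation[OF perm, of n W B] by (simp only: card.empty le_zero_eq)
qed

text \<open>Laplacian minors do not depend on the root, so one canonical root per block is enough
  and no sum over roots enters the weight. Extensionality makes the root maps elements of a finite
  \<open>PiE\<close>, over which partitions are grouped.\<close>

definition block_roots :: "nat \<Rightarrow> (nat \<Rightarrow> nat set) \<Rightarrow> nat \<Rightarrow> nat" where
  "block_roots K W = restrict (\<lambda>k. Min (W k)) {1..K}"

definition block_forests :: "nat \<Rightarrow> nat \<Rightarrow> (nat \<Rightarrow> nat set) \<Rightarrow> (nat \<Rightarrow> nat) set" where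
  "block_forests n K W =
     forests (\<lambda>i. W (label K W i)) ({1..n} - block_roots K W ` {1..K})"

lemma block_roots_mem:
  assumes "block_family n K W" "k \<in> {1..K}"
  shows "block_roots K W k \<in> W k"
  using Min_in[OF block_family_finite[OF assms] block_family_nonempty[OF assms]] assms(2)
  by (simp add: block_roots_def)

lemma label_block_roots:
  assumes "block_family n K W" "k \<in> {1..K}"
  shows "label K W (block_roots K W k) = k"
  using label_eq[OF assms block_roots_mem[OF assms]] .

lemma block_roots_PiE:
  assumes "block_family n K W"
  shows "block_roots K W \<in> PiE {1..K} (\<lambda>_. {1..n})"
proof (rule PiE_I)
  fix k assume k: "k \<in> {1..K}"
  show "block_roots K W k \<in> {1..n}" using block_roots_mem[OF assms k] block_family_subset[OF assms k] by auto
qed (auto simp: block_roots_def)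

lemma card_block_roots:
  assumes "block_family n K W"
  shows "card (block_roots K W ` {1..K}) = K"
proof -
  have "inj_on (block_roots K W) {1..K}"
    by (rule inj_on_inverseI[where g = "label K W"]) (rule label_block_roots[OF assms])
  then show ?thesis by (simp add: card_image)
qed

text \<open>One spanning tree per block, rooted at the canonical root, amounts to a single parent
  map on all other vertices that stays in the blocks.\<close>

lemma prod_laplacian_minor:
  assumes W: "block_family n K W" and sym: "\<And>i j. f i j = f j i"
  shows "(\<Prod>k\<in>{1..K}. laplacian_minor f (W k))
    = (\<Sum>\<phi>\<in>block_forests n K W. \<Prod>i\<in>{1..n} - block_roots K W ` {1..K}. f i (\<phi> i))"
proof -
  let ?T = "\<lambda>i. W (label K W i)"
  have "(\<Prod>k\<in>{1..K}. laplacian_minor f (W k))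
      = (\<Prod>k\<in>{1..K}. forest_sum f ?T (W k - {block_roots K W k}))"
  proof (rule prod.cong)
    fix k assume k: "k \<in> {1..K}"
    have "laplacian_minor f (W k) = forest_sum f (\<lambda>_. W k) (W k - {block_roots K W k})"
      by (rule laplacian_minor_forest_sum[where f = f, OF block_family_finite[OF W k] block_roots_mem[OF W k] sym])
    also have "\<dots> = forest_sum f ?T (W k - {block_roots K W k})"
      by (rule forest_sum_cong) (simp add: label_eq[OF W k])
    finally show "laplacian_minor f (W k) = forest_sum f ?T (W k - {block_roots K W k})" .
  qed simp
  also have "\<dots> = forest_sum f ?T (\<Union>k\<in>{1..K}. W k - {block_roots K W k})"
    using W block_family_finite[OF W] label_eq[OF W]
    by (intro forest_sum_UN[where B = W, symmetric]) (auto simp: block_family_def)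
  also have "(\<Union>k\<in>{1..K}. W k - {block_roots K W k}) = {1..n} - block_roots K W ` {1..K}"
  proof (intro equalityI subsetI)
    fix i assume "i \<in> (\<Union>k\<in>{1..K}. W k - {block_roots K W k})"
    then obtain k where k: "k \<in> {1..K}" "i \<in> W k" "i \<noteq> block_roots K W k" by auto
    have "i \<noteq> block_roots K W k'" if "k' \<in> {1..K}" for k'
      using k label_eq[OF W k(1,2)] label_block_roots[OF W that] by metis
    then show "i \<in> {1..n} - block_roots K W ` {1..K}"
      using k block_family_subset[OF W k(1)] by blast
  next
    fix i assume "i \<in> {1..n} - block_roots K W ` {1..K}"
    then show "i \<in> (\<Union>k\<in>{1..K}. W k - {block_roots K W k})" using label_mem[OF W, of i] by auto
  qed
  finally show ?thesis by (simp add: forest_sum_def block_forests_def)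
qed

text \<open>The roots and the edges determine an ordered partition, since the set of vertices on which
  two candidates disagree is closed under the parent map.\<close>

lemma block_forests_disjoint:
  assumes W: "W \<in> ordered_partitions n K" and W': "W' \<in> ordered_partitions n K"
    and roots: "block_roots K W = block_roots K W'"
    and \<phi>: "\<phi> \<in> block_forests n K W" "\<phi> \<in> block_forests n K W'"
  shows "W = W'"
proof -
  have bW: "block_family n K W" and bW': "block_family n K W'"
    using W W' by (simp_all add: ordered_partitions_iff)
  let ?U = "{1..n} - block_roots K W ` {1..K}"
  have ac: "acyclic_map \<phi> ?U" and mem: "\<And>i. i \<in> ?U \<Longrightarrow> \<phi> i \<in> W (label K W i)"
    and mem': "\<And>i. i \<in> ?U \<Longrightarrow> \<phi> i \<in> W' (label K W' i)"
    using \<phi> by (auto simp: block_forests_def forests_def roots)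
  define N where "N = {i \<in> {1..n}. label K W i \<noteq> label K W' i}"
  have NU: "N \<subseteq> ?U"
    using label_block_roots[OF bW] label_block_roots[OF bW'] by (auto simp: N_def roots)
  have "N = {}"
  proof (rule acyclic_mapD[OF ac NU])
    fix i assume iN: "i \<in> N"
    then have i: "i \<in> {1..n}" "i \<in> ?U" using NU by (auto simp: N_def)
    have "label K W (\<phi> i) = label K W i" "label K W' (\<phi> i) = label K W' i"
      using label_eq[OF bW label_mem(1)[OF bW i(1)] mem[OF i(2)]]
        label_eq[OF bW' label_mem(1)[OF bW' i(1)] mem'[OF i(2)]] by auto
    moreover have "\<phi> i \<in> {1..n}"
      using mem[OF i(2)] block_family_subset[OF bW label_mem(1)[OF bW i(1)]] by auto
    ultimately show "\<phi> i \<in> N" using iN by (auto simp: N_def)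
  qed
  then have lab: "label K W i = label K W' i" if "i \<in> {1..n}" for i using that by (auto simp: N_def)
  show ?thesis
  proof (rule extensionalityI)
    show "W \<in> extensional {1..K}" "W' \<in> extensional {1..K}"
      using W W' by (simp_all add: ordered_partitions_iff)
    fix k assume k: "k \<in> {1..K}"
    have "W k = {i \<in> {1..n}. label K W i = k}" using block_family_label_eq[OF bW k] ..
    also have "\<dots> = {i \<in> {1..n}. label K W' i = k}" using lab by auto
    also have "\<dots> = W' k" by (rule block_family_label_eq[OF bW' k])
    finally show "W k = W' k" .
  qed
qed

text \<open>Without a crossing edge the oracle label is constant along every tree, so
  \<open>W\<close> refines \<open>B\<close> and agrees with it up to labels.\<close>

lemma block_forests_crossing:
  assumes W: "block_family n K W" and B: "block_family n K B"
    and bad: "hamming n K W B \<noteq> 0" and \<phi>: "\<phi> \<in> block_forests n K W"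
  shows "\<exists>i\<in>{1..n} - block_roots K W ` {1..K}. label K B (\<phi> i) \<noteq> label K B i"
proof (rule ccontr)
  let ?U = "{1..n} - block_roots K W ` {1..K}"
  assume "\<not> ?thesis"
  then have within: "label K B (\<phi> i) = label K B i" if "i \<in> ?U" for i using that by auto
  have ac: "acyclic_map \<phi> ?U" and mem: "\<And>i. i \<in> ?U \<Longrightarrow> \<phi> i \<in> W (label K W i)"
    using \<phi> by (auto simp: block_forests_def forests_def)
  have root: "label K B i = label K B (block_roots K W k)" if k: "k \<in> {1..K}" and i: "i \<in> W k" for k i
  proof -
    \<comment> \<open>These vertices do not include the root and are closed under the parent map, so
      acyclicity leaves none.\<close>
    define N where "N = {i \<in> W k. label K B i \<noteq> label K B (block_roots K W k)}"
    have NU: "N \<subseteq> ?U"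
    proof
      fix j assume j: "j \<in> N"
      then have jW: "j \<in> W k" by (simp add: N_def)
      have "j \<noteq> block_roots K W k'" if "k' \<in> {1..K}" for k'
        using label_eq[OF W k jW] label_block_roots[OF W that] j by (auto simp: N_def)
      then show "j \<in> ?U" using jW block_family_subset[OF W k] by blast
    qed
    have "N = {}"
    proof (rule acyclic_mapD[OF ac NU])
      fix j assume j: "j \<in> N"
      then have "j \<in> ?U" "j \<in> W k" using NU by (auto simp: N_def)
      then show "\<phi> j \<in> N" using j mem[of j] within[of j] label_eq[OF W k, of j] by (auto simp: N_def)
    qed
    then show ?thesis using i by (auto simp: N_def)
  qed
  have "hamming n K W B = 0" using root by (intro hamming_refinement[OF W B]) metis
  then show False using bad by simp
qed

text \<open>The factor \<open>real n ^ K\<close> counts root maps. For a fixed one, the forests of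
  the misclustered partitions are disjoint families of crossing forests with a common root set, and
  this set has as many elements as there are clusters.\<close>

lemma misclustered_weight_le:
  assumes B: "block_family n K B"
    and sym: "\<And>i j. f i j = f j i" and f0: "\<And>i j. 0 \<le> f i j" and m: "0 < m" and \<epsilon>: "0 \<le> \<epsilon>"
    and within: "\<And>i j. i \<in> {1..n} \<Longrightarrow> j \<in> {1..n} \<Longrightarrow> i \<noteq> j \<Longrightarrow>
      label K B i = label K B j \<Longrightarrow> m \<le> f i j"
    and between: "\<And>i j. i \<in> {1..n} \<Longrightarrow> j \<in> {1..n} \<Longrightarrow>
      label K B i \<noteq> label K B j \<Longrightarrow> f i j \<le> \<epsilon> * m"
  shows "(\<Sum>W\<in>{W \<in> ordered_partitions n K. hamming n K W B \<noteq> 0}. \<Prod>k\<in>{1..K}. laplacian_minor f (W k))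
    \<le> real n ^ K * (((1 + real n * \<epsilon>) ^ n - 1) * (\<Prod>k\<in>{1..K}. laplacian_minor f (B k)))"
proof -
  define Bad where "Bad = {W \<in> ordered_partitions n K. hamming n K W B \<noteq> 0}"
  have bf: "block_family n K W" "W \<in> ordered_partitions n K" "hamming n K W B \<noteq> 0" if "W \<in> Bad" for W
    using that by (auto simp: Bad_def ordered_partitions_iff)
  have finOP: "finite (ordered_partitions n K)"
    unfolding ordered_partitions_def
    by (rule finite_subset[of _ "{1..K} \<rightarrow>\<^sub>E Pow {1..n}"]) (auto intro: finite_PiE)
  have finBad: "finite Bad" using finOP by (simp add: Bad_def)
  let ?C = "((1 + real n * \<epsilon>) ^ n - 1) * (\<Prod>k\<in>{1..K}. laplacian_minor f (B k))"
  have img: "label K B ` {1..n} = {1..K}" by (rule block_family_label_image[OF B])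
  have minor0: "0 \<le> laplacian_minor f (B k)" if k: "k \<in> {1..K}" for k
    using laplacian_minor_forest_sum[where f = f, OF block_family_finite[OF B k] block_roots_mem[OF B k] sym] f0
    by (auto intro: forest_sum_nonneg)
  have C0: "0 \<le> ?C"
  proof (intro mult_nonneg_nonneg prod_nonneg)
    show "0 \<le> (1 + real n * \<epsilon>) ^ n - 1" using one_le_power[of "1 + real n * \<epsilon>" n] \<epsilon> by simp
  qed (use minor0 in auto)
  have per_root: "(\<Sum>W\<in>{W \<in> Bad. block_roots K W = \<kappa>}. \<Prod>k\<in>{1..K}. laplacian_minor f (W k)) \<le> ?C" for \<kappa>
  proof (cases "{W \<in> Bad. block_roots K W = \<kappa>} = {}")
    case True
    show ?thesis using C0 by (simp only: True sum.empty)
  next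
    case False
    define U where "U = {1..n} - \<kappa> ` {1..K}"
    \<comment> \<open>A partition with these roots shows that \<open>\<kappa>\<close> has
      \<open>K\<close> distinct values in \<open>{1..n}\<close>; if there is none, the sum is
      empty.\<close>
    obtain W0 where W0: "W0 \<in> Bad" "block_roots K W0 = \<kappa>" using False by auto
    have cardR: "card (\<kappa> ` {1..K}) = card (label K B ` {1..n})"
      using card_block_roots[OF bf(1)[OF W0(1)]] unfolding W0(2) img by simp
    have Rsub: "\<kappa> ` {1..K} \<subseteq> {1..n}"
      using block_roots_PiE[OF bf(1)[OF W0(1)]] by (auto simp: W0(2))
    let ?S = "{\<phi> \<in> forests (\<lambda>_. {1..n}) U. \<exists>i\<in>U. label K B (\<phi> i) \<noteq> label K B i}"
    have finS: "finite ?S" using finite_forests[of U "\<lambda>_. {1..n}"] by (simp add: U_def)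
    have sub: "block_forests n K W \<subseteq> ?S" if "W \<in> Bad" "block_roots K W = \<kappa>" for W
    proof
      fix \<phi> assume \<phi>: "\<phi> \<in> block_forests n K W"
      then have PiE: "\<phi> \<in> PiE U (\<lambda>i. W (label K W i))" and ac: "acyclic_map \<phi> U"
        unfolding block_forests_def forests_def that(2) U_def by blast+
      have "PiE U (\<lambda>i. W (label K W i)) \<subseteq> PiE U (\<lambda>_. {1..n})"
      proof (rule PiE_mono)
        fix i assume "i \<in> U"
        then have "i \<in> {1..n}" by (simp add: U_def)
        then show "W (label K W i) \<subseteq> {1..n}"
          by (intro block_family_subset[OF bf(1)] label_mem(1)[OF bf(1)] that(1))
      qed
      then have "\<phi> \<in> forests (\<lambda>_. {1..n}) U" using PiE ac by (simp add: forests_def subset_iff)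
      then show "\<phi> \<in> ?S"
        using block_forests_crossing[OF bf(1)[OF that(1)] B bf(3)[OF that(1)] \<phi>] that(2)
        by (simp add: U_def)
    qed
    have "(\<Sum>W\<in>{W \<in> Bad. block_roots K W = \<kappa>}. \<Prod>k\<in>{1..K}. laplacian_minor f (W k))
        = (\<Sum>W\<in>{W \<in> Bad. block_roots K W = \<kappa>}. \<Sum>\<phi>\<in>block_forests n K W. \<Prod>i\<in>U. f i (\<phi> i))"
    proof (rule sum.cong)
      fix W assume "W \<in> {W \<in> Bad. block_roots K W = \<kappa>}"
      then have W: "W \<in> Bad" "block_roots K W = \<kappa>" by simp_all
      show "(\<Prod>k\<in>{1..K}. laplacian_minor f (W k))
          = (\<Sum>\<phi>\<in>block_forests n K W. \<Prod>i\<in>U. f i (\<phi> i))"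
        unfolding U_def W(2)[symmetric] by (rule prod_laplacian_minor[where f = f, OF bf(1)[OF W(1)] sym])
    qed simp
    \<comment> \<open>With the roots fixed, the edges determine the partition, so no forest is
      counted twice.\<close>
    also have "\<dots> = (\<Sum>\<phi>\<in>(\<Union>W\<in>{W \<in> Bad. block_roots K W = \<kappa>}. block_forests n K W). \<Prod>i\<in>U. f i (\<phi> i))"
    proof (rule sum.UNION_disjoint[symmetric])
      show "\<forall>W\<in>{W \<in> Bad. block_roots K W = \<kappa>}. finite (block_forests n K W)"
        using finite_subset[OF sub finS] by auto
      show "\<forall>W\<in>{W \<in> Bad. block_roots K W = \<kappa>}. \<forall>W'\<in>{W \<in> Bad. block_roots K W = \<kappa>}.
          W \<noteq> W' \<longrightarrow> block_forests n K W \<inter> block_forests n K W' = {}"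
        using block_forests_disjoint[OF bf(2) bf(2)] by auto
    qed (use finBad in simp)
    also have "\<dots> \<le> (\<Sum>\<phi>\<in>?S. \<Prod>i\<in>U. f i (\<phi> i))"
      using sub by (intro sum_mono2[OF finS]) (auto intro!: prod_nonneg f0)
    also have "\<dots> \<le> ((1 + real (card {1..n}) * \<epsilon>) ^ card {1..n} - 1) *
        (\<Prod>k\<in>label K B ` {1..n}. laplacian_minor f (B k))"
      unfolding U_def
    proof (rule crossing_forests_bound[where f = f, OF _ Rsub cardR sym f0 m \<epsilon> within between])
      fix k assume "k \<in> label K B ` {1..n}"
      then have k: "k \<in> {1..K}" unfolding img .
      then show "\<exists>v\<in>{1..n}. label K B v = k \<and> laplacian_minor f (B k)
          = forest_sum f (\<lambda>_. {i \<in> {1..n}. label K B i = k}) ({i \<in> {1..n}. label K B i = k} - {v})"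
        unfolding block_family_label_eq[OF B k]
        using laplacian_minor_forest_sum[where f = f, OF block_family_finite[OF B k] block_roots_mem[OF B k] sym]
          label_block_roots[OF B k] block_roots_mem[OF B k] block_family_subset[OF B k]
        by (intro bexI[of _ "block_roots K B k"]) auto
    qed auto
    finally show ?thesis unfolding img by simp
  qed
  have "(\<Sum>W\<in>Bad. \<Prod>k\<in>{1..K}. laplacian_minor f (W k))
      = (\<Sum>\<kappa>\<in>PiE {1..K} (\<lambda>_. {1..n}). \<Sum>W\<in>{W \<in> Bad. block_roots K W = \<kappa>}.
          \<Prod>k\<in>{1..K}. laplacian_minor f (W k))"
    using finBad block_roots_PiE[OF bf(1)]
    by (intro sum.group[symmetric]) (auto intro!: finite_PiE)
  also have "\<dots> \<le> (\<Sum>\<kappa>\<in>PiE {1..K} (\<lambda>_. {1..n}). ?C)" by (intro sum_mono per_root)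
  also have "\<dots> = real n ^ K * ?C" by (simp add: card_PiE)
  finally show ?thesis by (simp add: Bad_def)
qed

section \<open>The posterior for separated data\<close>

lemma finite_ordered_partitions: "finite (ordered_partitions n K)"
  unfolding ordered_partitions_def
  by (rule finite_subset[of _ "{1..K} \<rightarrow>\<^sub>E Pow {1..n}"]) (auto intro: finite_PiE)

lemma laplacian_minor_nonneg:
  assumes "block_family n K W" "k \<in> {1..K}" "\<And>i j. f i j = f j i" "\<And>i j. 0 \<le> f i j"
  shows "0 \<le> laplacian_minor f (W k)"
  using laplacian_minor_forest_sum[OF block_family_finite[OF assms(1,2)] block_roots_mem[OF assms(1,2)] assms(3)]
    assms(4) by (auto intro: forest_sum_nonneg)

text \<open>Taking every vertex as a root gives the empty forest with sum 1, from which
  \<open>forest_sum_roots_le\<close> yields a positive lower bound.\<close>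

lemma laplacian_minor_pos:
  assumes V: "finite V" "V \<noteq> {}" and sym: "\<And>i j. f i j = f j i" and f0: "\<And>i j. 0 \<le> f i j"
    and m: "0 < m" "\<And>i j. i \<in> V \<Longrightarrow> j \<in> V \<Longrightarrow> i \<noteq> j \<Longrightarrow> m \<le> f i j"
  shows "0 < laplacian_minor f V"
proof -
  obtain v where v: "v \<in> V" using V by auto
  have "m ^ card V * forest_sum f (\<lambda>_. V) (V - V) \<le> m * forest_sum f (\<lambda>_. V) (V - {v})"
    using m by (intro forest_sum_roots_le[where f = f, OF V(1) v _ sym f0]) auto
  then have "0 < m * forest_sum f (\<lambda>_. V) (V - {v})"
    using zero_less_power[OF m(1), of "card V"] by simp
  then show ?thesis
    using laplacian_minor_forest_sum[where f = f, OF V(1) v sym] m(1) by (simp add: zero_less_mult_iff)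
qed

lemma posterior_weight_nonneg:
  assumes "block_family n K W" "\<And>i j. f i j = f j i" "\<And>i j. 0 \<le> f i j" "\<And>x. 0 < r x"
  shows "0 \<le> posterior_weight f r y K W"
  unfolding posterior_weight_def using laplacian_minor_nonneg[OF assms(1)] assms(2-4)
  by (intro prod_nonneg mult_nonneg_nonneg sum_nonneg) (auto simp: less_imp_le)

lemma posterior_expectation_hamming_le:
  assumes sym: "\<And>i j. f i j = f j i" and f0: "\<And>i j. 0 \<le> f i j" and r: "\<And>x. 0 < r x"
  shows "posterior_expectation f r y n K (\<lambda>W. real (hamming n K W B)) \<le> real n"
proof -
  let ?w = "posterior_weight f r y K"
  define Z where "Z = (\<Sum>W\<in>ordered_partitions n K. ?w W)"
  have w0: "0 \<le> ?w W" if "W \<in> ordered_partitions n K" for W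
    using posterior_weight_nonneg[where f = f and r = r, OF _ sym f0 r] that
    unfolding ordered_partitions_iff by blast
  have Z0: "0 \<le> Z" unfolding Z_def by (intro sum_nonneg w0)
  have "posterior_expectation f r y n K (\<lambda>W. real (hamming n K W B))
      = (\<Sum>W\<in>ordered_partitions n K. real (hamming n K W B) * (?w W / Z))"
    by (simp add: posterior_expectation_def posterior_prob_def Z_def)
  also have "\<dots> \<le> (\<Sum>W\<in>ordered_partitions n K. real n * (?w W / Z))"
    using w0 Z0 hamming_le by (intro sum_mono mult_right_mono) auto
  also have "\<dots> = real n * (Z / Z)"
    by (simp add: sum_distrib_left[symmetric] sum_divide_distrib[symmetric] Z_def)
  \<comment> \<open>If the normalizing constant vanishes, division by zero makes all posterior
    probabilities 0.\<close>
  also have "\<dots> \<le> real n" by (cases "Z = 0") auto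
  finally show ?thesis .
qed

text \<open>With \<open>x = n ^ 2 * \<epsilon>\<close> the power is at most \<open>exp x\<close>,
  and \<open>exp x \<le> 1 + 2 * x\<close> on the unit interval. This is where
  \<open>\<epsilon>\<close> must be of order \<open>1 / n ^ 2\<close>.\<close>

lemma one_plus_power_minus_one_le:
  fixes \<epsilon> :: real
  assumes "0 \<le> \<epsilon>" "real n ^ 2 * \<epsilon> \<le> 1"
  shows "(1 + real n * \<epsilon>) ^ n - 1 \<le> 2 * real n ^ 2 * \<epsilon>"
proof -
  define x where "x = real n ^ 2 * \<epsilon>"
  have x: "0 \<le> x" "x \<le> 1" using assms by (simp_all add: x_def)
  have "(1 + real n * \<epsilon>) ^ n \<le> exp (real n * \<epsilon>) ^ n"
    using assms by (intro power_mono) (auto simp: exp_ge_add_one_self)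
  also have "\<dots> = exp x" by (simp add: exp_of_nat_mult[symmetric] x_def power2_eq_square mult_ac)
  also have "\<dots> \<le> 1 + x + x\<^sup>2" by (rule exp_bound[OF x])
  also have "x\<^sup>2 \<le> x" using x by (simp add: power2_eq_square mult_left_le)
  finally show ?thesis by (simp add: x_def mult_ac)
qed

text \<open>The factors are: \<open>n\<close> for the Hamming distance, \<open>(n * c2) ^ K\<close>
  for the root sums in the numerator, \<open>n ^ K\<close> for the choice of roots,
  \<open>2 * n ^ 2 * \<epsilon>\<close> for the crossing edges, and \<open>c1 ^ K\<close> in the
  denominator, of which only the oracle term is kept.\<close>

lemma posterior_expectation_hamming_separated:
  assumes B: "block_family n K B"
    and sym: "\<And>i j. f i j = f j i" and f0: "\<And>i j. 0 \<le> f i j" and m: "0 < m"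
    and \<epsilon>: "0 \<le> \<epsilon>" "real n ^ 2 * \<epsilon> \<le> 1"
    and within: "\<And>i j. i \<in> {1..n} \<Longrightarrow> j \<in> {1..n} \<Longrightarrow> i \<noteq> j \<Longrightarrow>
      label K B i = label K B j \<Longrightarrow> m \<le> f i j"
    and between: "\<And>i j. i \<in> {1..n} \<Longrightarrow> j \<in> {1..n} \<Longrightarrow>
      label K B i \<noteq> label K B j \<Longrightarrow> f i j \<le> \<epsilon> * m"
    and r: "\<And>x. 0 < r x" and c1: "0 < c1"
    and rc: "\<And>i. i \<in> {1..n} \<Longrightarrow> c1 \<le> r (y i)" "\<And>i. i \<in> {1..n} \<Longrightarrow> r (y i) \<le> c2"
  shows "posterior_expectation f r y n K (\<lambda>W. real (hamming n K W B))
    \<le> 2 * real n ^ 3 * (real n ^ 2 * (c2 / c1)) ^ K * \<epsilon>"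
proof -
  let ?w = "posterior_weight f r y K"
  define M where "M = (\<lambda>W. \<Prod>k\<in>{1..K}. laplacian_minor f (W k))"
  define Z where "Z = (\<Sum>W\<in>ordered_partitions n K. ?w W)"
  define Bad where "Bad = {W \<in> ordered_partitions n K. hamming n K W B \<noteq> 0}"
  have w0: "0 \<le> ?w W" if "W \<in> ordered_partitions n K" for W
    using posterior_weight_nonneg[where f = f and r = r, OF _ sym f0 r] that
    unfolding ordered_partitions_iff by blast
  have finB: "finite (B k)" and neB: "B k \<noteq> {}" if "k \<in> {1..K}" for k
    using block_family_finite[OF B that] block_family_nonempty[OF B that] by auto
  have minor_pos: "0 < laplacian_minor f (B k)" if k: "k \<in> {1..K}" for k
  proof (rule laplacian_minor_pos[where f = f, OF finB[OF k] neB[OF k] sym f0 m])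
    fix i j assume ij: "i \<in> B k" "j \<in> B k" "i \<noteq> j"
    show "m \<le> f i j"
    proof (rule within)
      show "i \<in> {1..n}" "j \<in> {1..n}" using ij block_family_subset[OF B k] by blast+
      show "label K B i = label K B j" using label_eq[OF B k ij(1)] label_eq[OF B k ij(2)] by simp
    qed (rule ij(3))
  qed
  have Mpos: "0 < M B" unfolding M_def using minor_pos by (intro prod_pos) auto
  have w_le: "?w W \<le> (real n * c2) ^ K * M W" if "W \<in> ordered_partitions n K" for W
  proof -
    have W: "block_family n K W" using that by (simp add: ordered_partitions_iff)
    have "?w W \<le> (\<Prod>k\<in>{1..K}. (real n * c2) * laplacian_minor f (W k))"
      unfolding posterior_weight_def
    proof (rule prod_mono)
      fix k assume k: "k \<in> {1..K}"
      have c20: "0 \<le> c2"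
      proof -
        obtain i where "i \<in> W k" using block_family_nonempty[OF W k] by auto
        then have "i \<in> {1..n}" using block_family_subset[OF W k] by auto
        then show ?thesis using rc(2) r[of "y i"] by (meson less_imp_le order_trans)
      qed
      have "(\<Sum>i\<in>W k. r (y i)) \<le> real (card (W k)) * c2"
        using block_family_subset[OF W k] rc(2) by (intro sum_bounded_above) auto
      also have "\<dots> \<le> real n * c2"
        using card_mono[OF _ block_family_subset[OF W k]] c20 by (intro mult_right_mono) auto
      finally show "0 \<le> (\<Sum>i\<in>W k. r (y i)) * laplacian_minor f (W k) \<and>
          (\<Sum>i\<in>W k. r (y i)) * laplacian_minor f (W k) \<le> real n * c2 * laplacian_minor f (W k)"
        using laplacian_minor_nonneg[where f = f, OF W k sym f0] r
        by (auto intro!: mult_nonneg_nonneg mult_right_mono sum_nonneg simp: less_imp_le)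
    qed
    then show ?thesis by (simp add: M_def prod.distrib)
  qed
  have Z_ge: "c1 ^ K * M B \<le> Z"
  proof -
    \<comment> \<open>Only the restriction of \<open>B\<close> to its labels is an element of
      \<open>ordered_partitions\<close>.\<close>
    define B' where "B' = restrict B {1..K}"
    have B'k: "B' k = B k" if "k \<in> {1..K}" for k using that by (simp add: B'_def)
    have "block_family n K B'"
      using B B'k by (auto simp: block_family_def disjoint_family_on_def)
    then have OP: "B' \<in> ordered_partitions n K" by (auto simp: ordered_partitions_iff B'_def)
    have "c1 ^ K * M B = (\<Prod>k\<in>{1..K}. c1 * laplacian_minor f (B k))"
      by (simp add: M_def prod.distrib)
    also have "\<dots> \<le> (\<Prod>k\<in>{1..K}. (\<Sum>i\<in>B k. r (y i)) * laplacian_minor f (B k))"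
    proof (rule prod_mono)
      fix k assume k: "k \<in> {1..K}"
      obtain i where i: "i \<in> B k" using neB[OF k] by auto
      have "c1 \<le> r (y i)" using i block_family_subset[OF B k] rc(1) by auto
      also have "\<dots> \<le> (\<Sum>i\<in>B k. r (y i))"
        using i finB[OF k] r by (intro member_le_sum) (auto simp: less_imp_le)
      finally show "0 \<le> c1 * laplacian_minor f (B k) \<and>
          c1 * laplacian_minor f (B k) \<le> (\<Sum>i\<in>B k. r (y i)) * laplacian_minor f (B k)"
        using minor_pos[OF k] c1 by auto
    qed
    also have "\<dots> = ?w B'" unfolding posterior_weight_def by (intro prod.cong) (simp_all add: B'k)
    also have "\<dots> \<le> Z" unfolding Z_def
      using OP w0 by (intro member_le_sum finite_ordered_partitions) auto
    finally show ?thesis .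
  qed
  have Zpos: "0 < Z" using Z_ge c1 Mpos by (meson less_le_trans mult_pos_pos zero_less_power)
  have c20: "0 \<le> (real n * c2) ^ K"
  proof (cases "n = 0")
    case False
    then have "0 \<le> c2" using rc(2)[of 1] r[of "y 1"] by auto
    then show ?thesis by simp
  qed simp
  have "posterior_expectation f r y n K (\<lambda>W. real (hamming n K W B))
      = (\<Sum>W\<in>ordered_partitions n K. real (hamming n K W B) * (?w W / Z))"
    by (simp add: posterior_expectation_def posterior_prob_def Z_def)
  also have "\<dots> = (\<Sum>W\<in>Bad. real (hamming n K W B) * (?w W / Z))"
    unfolding Bad_def using finite_ordered_partitions by (intro sum.mono_neutral_right) auto
  also have "\<dots> \<le> (\<Sum>W\<in>Bad. real n * ((real n * c2) ^ K * M W / Z))"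
  proof (rule sum_mono)
    fix W assume "W \<in> Bad"
    then have W: "W \<in> ordered_partitions n K" by (simp add: Bad_def)
    show "real (hamming n K W B) * (?w W / Z) \<le> real n * ((real n * c2) ^ K * M W / Z)"
      using w0[OF W] w_le[OF W] Zpos hamming_le[of n K W B]
      by (intro mult_mono divide_right_mono) auto
  qed
  also have "\<dots> = real n * (real n * c2) ^ K / Z * (\<Sum>W\<in>Bad. M W)"
    unfolding sum_distrib_left by (intro sum.cong) simp_all
  also have "\<dots> \<le> real n * (real n * c2) ^ K / Z * (real n ^ K * (2 * real n ^ 2 * \<epsilon> * M B))"
  proof (rule mult_left_mono)
    have "(\<Sum>W\<in>Bad. M W) \<le> real n ^ K * (((1 + real n * \<epsilon>) ^ n - 1) * M B)"
      unfolding Bad_def M_def by (rule misclustered_weight_le[where f = f, OF B sym f0 m \<epsilon>(1) within between])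
    also have "\<dots> \<le> real n ^ K * (2 * real n ^ 2 * \<epsilon> * M B)"
      using one_plus_power_minus_one_le[OF \<epsilon>] Mpos by (intro mult_left_mono mult_right_mono) auto
    finally show "(\<Sum>W\<in>Bad. M W) \<le> real n ^ K * (2 * real n ^ 2 * \<epsilon> * M B)" .
  qed (use Zpos c20 in auto)
  also have "\<dots> = real n * (real n * c2) ^ K * (real n ^ K * (2 * real n ^ 2 * \<epsilon> * M B)) / Z"
    by simp
  also have "\<dots> \<le> real n * (real n * c2) ^ K * (real n ^ K * (2 * real n ^ 2 * \<epsilon> * M B)) / (c1 ^ K * M B)"
    using Z_ge Mpos c1 c20 \<epsilon> by (intro divide_left_mono) (auto intro!: mult_nonneg_nonneg mult_pos_pos Zpos)
  also have "\<dots> = 2 * real n ^ 3 * (real n ^ 2 * (c2 / c1)) ^ K * \<epsilon>"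
    using Mpos c1 by (simp add: field_simps power2_eq_square power3_eq_cube power_mult_distrib power_divide)
  finally show ?thesis .
qed

text \<open>For \<open>K \<le> sqrt n\<close> the logarithm of the left side is of order
  \<open>sqrt n * ln n\<close>, whereas \<open>K \<ge> 1\<close> makes the right side at least
  \<open>2 ^ n\<close>. The quantifier over \<open>K\<close> stands inside, so that the threshold
  for \<open>n\<close> is uniform in \<open>K\<close>.\<close>

lemma eventually_polynomial_power_le:
  fixes c :: real
  assumes "1 \<le> c"
  shows "\<forall>\<^sub>F n in sequentially. \<forall>K. 1 \<le> K \<longrightarrow> real K \<le> sqrt (real n) \<longrightarrow>
    2 * real n ^ 3 * (real n ^ 2 * c) ^ K \<le> exp (real n * ln (real K + 1))"
proof -
  have "\<forall>\<^sub>F n in sequentially. 2 * real n ^ 3 * exp (sqrt (real n) * ln (real n ^ 2 * c)) \<le> exp (real n * ln 2)"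
    using assms by real_asymp
  then show ?thesis using eventually_ge_at_top[of 1]
  proof eventually_elim
    case (elim n)
    have x: "1 \<le> real n ^ 2 * c" using elim(2) assms mult_mono[of 1 "real n ^ 2" 1 c] by simp
    show ?case
    proof (intro allI impI)
      fix K :: nat assume K: "1 \<le> K" "real K \<le> sqrt (real n)"
      have "(real n ^ 2 * c) ^ K = exp (real K * ln (real n ^ 2 * c))"
        using x by (subst exp_of_nat_mult) (simp add: exp_ln)
      also have "\<dots> \<le> exp (sqrt (real n) * ln (real n ^ 2 * c))"
        using K(2) x by (subst exp_le_cancel_iff) (intro mult_right_mono ln_ge_zero)
      finally have "2 * real n ^ 3 * (real n ^ 2 * c) ^ K
          \<le> 2 * real n ^ 3 * exp (sqrt (real n) * ln (real n ^ 2 * c))"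
        by (intro mult_left_mono) auto
      also have "\<dots> \<le> exp (real n * ln 2)" by (rule elim(1))
      also have "\<dots> \<le> exp (real n * ln (real K + 1))"
        using K(1) by (subst exp_le_cancel_iff) (auto intro!: mult_left_mono)
      finally show "2 * real n ^ 3 * (real n ^ 2 * c) ^ K \<le> exp (real n * ln (real K + 1))" .
    qed
  qed
qed

section \<open>The distribution of the distances\<close>

lemma oracle_block_family:
  assumes dis: "disjoint_family_on V0 {1..}" and cover: "(\<Union>k\<in>{1..}. V0 k) = {1..}"
    and lab: "bij_betw (lab n) {1..oracle_K V0 n} (oracle_indices V0 n)"
  shows "block_family n (oracle_K V0 n) (oracle_block V0 lab n)"
proof -
  let ?I = "{1..oracle_K V0 n}"
  have lab_mem: "lab n k \<ge> 1" "V0 (lab n k) \<inter> {1..n} \<noteq> {}" if "k \<in> ?I" for k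
    using bij_betwE[OF lab, rule_format, OF that] by (auto simp: oracle_indices_def)
  have "disjoint_family_on (oracle_block V0 lab n) ?I"
    unfolding disjoint_family_on_def
  proof (intro ballI impI)
    fix k l assume kl: "k \<in> ?I" "l \<in> ?I" "k \<noteq> l"
    then have "lab n k \<noteq> lab n l" using bij_betw_imp_inj_on[OF lab] by (auto dest: inj_onD)
    then show "oracle_block V0 lab n k \<inter> oracle_block V0 lab n l = {}"
      using dis lab_mem(1)[OF kl(1)] lab_mem(1)[OF kl(2)]
      by (auto simp: disjoint_family_on_def oracle_block_def)
  qed
  moreover have "(\<Union>k\<in>?I. oracle_block V0 lab n k) = {1..n}"
  proof (intro equalityI subsetI)
    fix i assume i: "i \<in> {1..n}"
    then have "i \<in> (\<Union>k\<in>{1..}. V0 k)" using cover by auto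
    then obtain k where k: "1 \<le> k" "i \<in> V0 k" by auto
    then have "k \<in> oracle_indices V0 n" using i by (auto simp: oracle_indices_def)
    then obtain j where "j \<in> ?I" "lab n j = k" using bij_betw_imp_surj_on[OF lab] by (metis imageE)
    then show "i \<in> (\<Union>k\<in>?I. oracle_block V0 lab n k)" using i k by (auto simp: oracle_block_def)
  qed (auto simp: oracle_block_def)
  ultimately show ?thesis using lab_mem(2) by (auto simp: block_family_def oracle_block_def)
qed

lemma block_family_pos: "block_family n K B \<Longrightarrow> 1 \<le> n \<Longrightarrow> 1 \<le> K"
  using label_mem(1)[of n K B 1] by simp

lemma same_cluster_label:
  assumes "block_family n K (oracle_block V0 lab n)" "bij_betw (lab n) {1..K} (oracle_indices V0 n)"
    and "k \<in> {1..K}" "s \<in> oracle_block V0 lab n k" "t \<in> oracle_block V0 lab n k"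
  shows "same_cluster V0 s t"
proof -
  have "lab n k \<in> oracle_indices V0 n" using assms(2,3) by (auto simp: bij_betw_def)
  then show ?thesis using assms(4,5)
    by (auto simp: same_cluster_def oracle_block_def oracle_indices_def)
qed

text \<open>The law of a distance is the image of the pair law under \<open>dist\<close>, so all
  admissible pairs give the same measure and the definite description is determined.\<close>

lemma distance_law_eq:
  fixes P :: "(nat \<Rightarrow> 'a::{metric_space, second_countable_topology}) measure"
  assumes sets: "sets P = sets (Pi\<^sub>M {1..n} (\<lambda>_. borel))"
    and ST: "S \<subseteq> {1..n}" "T \<subseteq> {1..n}" and st: "s \<in> S" "t \<in> T" "s \<noteq> t"
    and law: "\<And>s' t'. s' \<in> S \<Longrightarrow> t' \<in> T \<Longrightarrow> s' \<noteq> t' \<Longrightarrow> pair_law P s' t' = pair_law P s t"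
  shows "distance_law P S T = distr P borel (\<lambda>y. dist (y s) (y t))"
  unfolding distance_law_def
proof (rule the_equality)
  have comp: "(\<lambda>y. y i) \<in> measurable P borel" if "i \<in> {1..n}" for i
    using measurable_component_singleton[OF that, of "\<lambda>_. borel"]
    by (simp add: measurable_cong_sets[OF sets refl])
  have dist_distr: "distr P borel (\<lambda>y. dist (y s') (y t')) = distr (pair_law P s' t') borel (\<lambda>(x, z). dist x z)"
    if "s' \<in> S" "t' \<in> T" for s' t'
  proof -
    have "(\<lambda>y. (y s', y t')) \<in> measurable P (borel \<Otimes>\<^sub>M borel)"
      using that ST by (intro measurable_Pair comp) auto
    moreover have "(\<lambda>(x :: 'a, z). dist x z) \<in> measurable (borel \<Otimes>\<^sub>M borel) borel" by measurable
    ultimately show ?thesis by (simp add: pair_law_def distr_distr comp_def)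
  qed
  show "\<mu> = distr P borel (\<lambda>y. dist (y s) (y t))"
    if ex: "\<exists>s\<in>S. \<exists>t\<in>T. s \<noteq> t \<and> \<mu> = distr P borel (\<lambda>y. dist (y s) (y t))" for \<mu>
  proof -
    obtain s' t' where st': "s' \<in> S" "t' \<in> T" "s' \<noteq> t'" "\<mu> = distr P borel (\<lambda>y. dist (y s') (y t'))"
      using ex by blast
    then show ?thesis using dist_distr[OF st'(1,2)] dist_distr[OF st(1,2)] law[OF st'(1-3)] by simp
  qed
qed (use st in blast)

section \<open>The exceptional event on the distances\<close>

lemma sup_prob_upper:
  assumes "finite I" "i \<in> I"
  shows "p i \<le> sup_prob I p"
  using assms by (auto simp: sup_prob_def intro!: cSUP_upper)

lemma sup_prob_nonneg:
  assumes "finite I" "\<And>i. i \<in> I \<Longrightarrow> 0 \<le> p i"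
  shows "0 \<le> sup_prob I p"
proof (cases "I = {}")
  case False
  then obtain i where "i \<in> I" by auto
  then show ?thesis using assms(2) sup_prob_upper[OF assms(1), of i p] by fastforce
qed (simp add: sup_prob_def)

lemma between_prob_nonneg: "0 \<le> between_prob P B K a"
  unfolding between_prob_def
  by (rule sup_prob_nonneg) (auto intro: finite_subset[of _ "{1..K} \<times> {1..K}"])

lemma within_prob_nonneg: "0 \<le> within_prob P B K b"
  unfolding within_prob_def by (rule sup_prob_nonneg) auto

lemma measure_distance_law:
  fixes P :: "(nat \<Rightarrow> 'a::{metric_space, second_countable_topology}) measure"
  assumes sets: "sets P = sets (Pi\<^sub>M {1..n} (\<lambda>_. borel))"
    and st: "s \<in> {1..n}" "t \<in> {1..n}" and X: "X \<in> sets borel"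
  shows "measure (distr P borel (\<lambda>y. dist (y s) (y t))) X = measure P {y \<in> space P. dist (y s) (y t) \<in> X}"
    and "{y \<in> space P. dist (y s) (y t) \<in> X} \<in> sets P"
proof -
  have comp: "(\<lambda>y. y i) \<in> measurable P borel" if "i \<in> {1..n}" for i
    using measurable_component_singleton[OF that, of "\<lambda>_. borel"]
    by (simp add: measurable_cong_sets[OF sets refl])
  have meas: "(\<lambda>y. dist (y s) (y t)) \<in> measurable P borel"
    using comp[OF st(1)] comp[OF st(2)] by measurable
  have "(\<lambda>y. dist (y s) (y t)) -` X \<inter> space P = {y \<in> space P. dist (y s) (y t) \<in> X}" by auto
  then show "measure (distr P borel (\<lambda>y. dist (y s) (y t))) X = measure P {y \<in> space P. dist (y s) (y t) \<in> X}"
    "{y \<in> space P. dist (y s) (y t) \<in> X} \<in> sets P"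
    using measure_distr[OF meas X] measurable_sets[OF meas X] by simp_all
qed

definition atypical_pair ::
    "(nat \<Rightarrow> 'a::metric_space) measure \<Rightarrow> (nat \<Rightarrow> nat set) \<Rightarrow> nat \<Rightarrow> real \<Rightarrow> real \<Rightarrow> nat \<Rightarrow> nat \<Rightarrow>
     (nat \<Rightarrow> 'a) set" where
  "atypical_pair P B K a b s t = {y \<in> space P. dist (y s) (y t) \<in>
     (if label K B s = label K B t then {x. x\<^sup>2 > b} else {x. x\<^sup>2 < a})}"

lemma atypical_pair_prob:
  fixes P :: "(nat \<Rightarrow> 'a::{metric_space, second_countable_topology}) measure"
  assumes sets: "sets P = sets (Pi\<^sub>M {1..n} (\<lambda>_. borel))" and B: "block_family n K B"
    and st: "s \<in> {1..n}" "t \<in> {1..n}" "s \<noteq> t"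
    and law: "\<And>s t s' t'. {s, t, s', t'} \<subseteq> {1..n} \<Longrightarrow> s \<noteq> t \<Longrightarrow> s' \<noteq> t' \<Longrightarrow>
      label K B s = label K B s' \<Longrightarrow> label K B t = label K B t' \<Longrightarrow> pair_law P s t = pair_law P s' t'"
  shows "atypical_pair P B K a b s t \<in> sets P"
    and "measure P (atypical_pair P B K a b s t) \<le> between_prob P B K a + within_prob P B K b"
proof -
  define k where "k = label K B s"
  define l where "l = label K B t"
  have k: "k \<in> {1..K}" "s \<in> B k" and l: "l \<in> {1..K}" "t \<in> B l"
    using label_mem[OF B] st by (auto simp: k_def l_def)
  have X: "{x. x\<^sup>2 > b} \<in> sets (borel :: real measure)" "{x. x\<^sup>2 < a} \<in> sets (borel :: real measure)"
    by measurable
  have dl: "distance_law P (B k) (B l) = distr P borel (\<lambda>y. dist (y s) (y t))"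
  proof (rule distance_law_eq[OF sets block_family_subset[OF B k(1)] block_family_subset[OF B l(1)] k(2) l(2) st(3)])
    fix s' t' assume st': "s' \<in> B k" "t' \<in> B l" "s' \<noteq> t'"
    show "pair_law P s' t' = pair_law P s t"
      using st st' k l label_eq[OF B k(1)] label_eq[OF B l(1)]
        block_family_subset[OF B k(1)] block_family_subset[OF B l(1)]
      by (intro law) auto
  qed
  show "atypical_pair P B K a b s t \<in> sets P"
    unfolding atypical_pair_def using X by (intro measure_distance_law(2)[OF sets st(1,2)]) auto
  show "measure P (atypical_pair P B K a b s t) \<le> between_prob P B K a + within_prob P B K b"
  proof (cases "k = l")
    case True
    have "measure P (atypical_pair P B K a b s t)
        = measure (distance_law P (B k) (B k)) {x. x\<^sup>2 > b}"
      using True dl measure_distance_law(1)[OF sets st(1,2) X(1)]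
      by (simp add: atypical_pair_def k_def l_def)
    also have "\<dots> \<le> within_prob P B K b"
      unfolding within_prob_def
      using k l st(3) True by (intro sup_prob_upper[where i = k]) auto
    finally show ?thesis using between_prob_nonneg[of P B K a] by simp
  next
    case False
    have "measure P (atypical_pair P B K a b s t)
        = measure (distance_law P (B k) (B l)) {x. x\<^sup>2 < a}"
      using False dl measure_distance_law(1)[OF sets st(1,2) X(2)]
      by (simp add: atypical_pair_def k_def l_def)
    also have "\<dots> \<le> between_prob P B K a"
    proof -
      have "finite {(k, l). k \<in> {1..K} \<and> l \<in> {1..K} \<and> k \<noteq> l}"
        by (rule finite_subset[of _ "{1..K} \<times> {1..K}"]) auto
      then show ?thesis
        unfolding between_prob_def
        using sup_prob_upper[of "{(k, l). k \<in> {1..K} \<and> l \<in> {1..K} \<and> k \<noteq> l}" "(k, l)"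
            "\<lambda>(k, l). measure (distance_law P (B k) (B l)) {x. x\<^sup>2 < a}"] k l False by simp
    qed
    finally show ?thesis using within_prob_nonneg[of P B K b] by simp
  qed
qed

lemma atypical_prob:
  fixes P :: "(nat \<Rightarrow> 'a::{metric_space, second_countable_topology}) measure" and a b :: real
  assumes P: "prob_space P"
    and sets: "sets P = sets (Pi\<^sub>M {1..n} (\<lambda>_. borel))" and B: "block_family n K B"
    and law: "\<And>s t s' t'. {s, t, s', t'} \<subseteq> {1..n} \<Longrightarrow> s \<noteq> t \<Longrightarrow> s' \<noteq> t' \<Longrightarrow>
      label K B s = label K B s' \<Longrightarrow> label K B t = label K B t' \<Longrightarrow> pair_law P s t = pair_law P s' t'"
  defines "A \<equiv> (\<Union>(s, t)\<in>{(s, t). s \<in> {1..n} \<and> t \<in> {1..n} \<and> s \<noteq> t}. atypical_pair P B K a b s t)"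
  shows "A \<in> sets P"
    and "measure P A \<le> real n ^ 2 * (between_prob P B K a + within_prob P B K b)"
proof -
  interpret prob_space P by (rule P)
  let ?I = "{(s, t). s \<in> {1..n} \<and> t \<in> {1..n} \<and> s \<noteq> t}"
  let ?q = "between_prob P B K a + within_prob P B K b"
  have finI: "finite ?I" by (rule finite_subset[of _ "{1..n} \<times> {1..n}"]) auto
  have q0: "0 \<le> ?q" using between_prob_nonneg within_prob_nonneg by (rule add_nonneg_nonneg)
  have pair: "(case p of (s, t) \<Rightarrow> atypical_pair P B K a b s t) \<in> sets P"
    "measure P (case p of (s, t) \<Rightarrow> atypical_pair P B K a b s t) \<le> ?q" if "p \<in> ?I" for p
    using that atypical_pair_prob[OF sets B _ _ _ law, of "fst p" "snd p" a b]
    by (auto simp: case_prod_beta)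
  show "A \<in> sets P" unfolding A_def using finI pair(1) by (intro sets.finite_UN) auto
  have "measure P A \<le> (\<Sum>p\<in>?I. measure P (case p of (s, t) \<Rightarrow> atypical_pair P B K a b s t))"
    unfolding A_def using finI pair(1) by (intro finite_measure_subadditive_finite) auto
  also have "\<dots> \<le> real (card ?I) * ?q" by (rule sum_bounded_above) (rule pair(2))
  also have "\<dots> \<le> real (card ({1..n} \<times> {1..n})) * ?q"
    using q0 by (intro mult_right_mono of_nat_mono card_mono) auto
  finally show "measure P A \<le> real n ^ 2 * ?q" by (simp add: power2_eq_square)
qed

section \<open>The expected Hamming distance for a fixed sample size\<close>

lemma gaussian_constant_pos:
  assumes "(\<exists>\<iota> :: 'a::metric_space \<Rightarrow> real ^ 'p::finite. euclidean_gaussian \<iota> \<zeta>) \<or>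
      (\<exists>(A :: ('a, 'p) chart set) g vol. riemannian_gaussian A g vol \<zeta>)"
    and "0 < \<sigma>"
  shows "0 < \<zeta> \<sigma>"
  using assms(1)
proof
  assume "\<exists>\<iota> :: 'a \<Rightarrow> real ^ 'p. euclidean_gaussian \<iota> \<zeta>"
  then show ?thesis using assms(2) by (auto simp: euclidean_gaussian_def)
next
  assume "\<exists>(A :: ('a, 'p) chart set) g vol. riemannian_gaussian A g vol \<zeta>"
  then obtain vol :: "'a measure" where
    vol: "\<forall>z. (\<integral>\<^sup>+x. ennreal (\<zeta> \<sigma> * exp (- (dist x z)\<^sup>2 / (2 * \<sigma>\<^sup>2))) \<partial>vol) = 1"
    using assms(2) by (auto simp: riemannian_gaussian_def)
  show ?thesis
  proof (rule ccontr)
    assume "\<not> ?thesis"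
    \<comment> \<open>A nonpositive integrand becomes zero under \<open>ennreal\<close>, so the
      integral could not be 1.\<close>
    then have "\<zeta> \<sigma> * exp (- (dist x z)\<^sup>2 / (2 * \<sigma>\<^sup>2)) \<le> 0" for x z :: 'a
      by (intro mult_nonpos_nonneg) auto
    then have "(\<integral>\<^sup>+x. ennreal (\<zeta> \<sigma> * exp (- (dist x z)\<^sup>2 / (2 * \<sigma>\<^sup>2))) \<partial>vol) = 0" for z
      by (simp add: ennreal_neg)
    then show False using vol by simp
  qed
qed

text \<open>Off the exceptional event the posterior expectation is at most the exponential term. On
  the event it is at most \<open>n\<close>, and the union bound over at most \<open>n ^ 2\<close>
  ordered pairs turns this into the factor \<open>n ^ 3\<close>.\<close>

lemma expected_hamming_le:
  fixes P :: "(nat \<Rightarrow> 'a::{metric_space, second_countable_topology}) measure"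
  assumes P: "prob_space P" and sets: "sets P = sets (Pi\<^sub>M {1..n} (\<lambda>_. borel))"
    and n: "1 \<le> n" and B: "block_family n K B"
    and law: "\<And>s t s' t'. {s, t, s', t'} \<subseteq> {1..n} \<Longrightarrow> s \<noteq> t \<Longrightarrow> s' \<noteq> t' \<Longrightarrow>
      label K B s = label K B s' \<Longrightarrow> label K B t = label K B t' \<Longrightarrow> pair_law P s t = pair_law P s' t'"
    and \<zeta>: "0 < \<zeta> \<sigma>" and \<sigma>: "0 < \<sigma>" and r: "\<And>x. 0 < r x" and c1: "0 < c1"
    and rc: "AE y in P. c1 \<le> Min ((\<lambda>i. r (y i)) ` {1..n}) \<and> Max ((\<lambda>i. r (y i)) ` {1..n}) \<le> c2"
    and gap: "b < a \<Longrightarrow> 2 * ln (real n) \<le> (a - b) / (2 * \<sigma>\<^sup>2)"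
    and poly: "2 * real n ^ 3 * (real n ^ 2 * (c2 / c1)) ^ K \<le> exp (real n * ln (real K + 1))"
  shows "(\<integral>\<^sup>+ y. ennreal (posterior_expectation (gaussian_weight \<zeta> \<sigma> y) r y n K
        (\<lambda>W. real (hamming n K W B))) \<partial>P)
    \<le> ennreal (exp (- (a - b) / (2 * \<sigma>\<^sup>2) + real n * ln (real K + 1)) +
         real n ^ 3 * (between_prob P B K a + within_prob P B K b))"
proof -
  interpret prob_space P by (rule P)
  define \<epsilon> where "\<epsilon> = exp (- (a - b) / (2 * \<sigma>\<^sup>2))"
  define D where "D = exp (- (a - b) / (2 * \<sigma>\<^sup>2) + real n * ln (real K + 1))"
  define A where "A = (\<Union>(s, t)\<in>{(s, t). s \<in> {1..n} \<and> t \<in> {1..n} \<and> s \<noteq> t}. atypical_pair P B K a b s t)"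
  define F where "F = (\<lambda>y. posterior_expectation (gaussian_weight \<zeta> \<sigma> y) r y n K (\<lambda>W. real (hamming n K W B)))"
  let ?q = "between_prob P B K a + within_prob P B K b"
  have A: "A \<in> sets P" "measure P A \<le> real n ^ 2 * ?q"
    unfolding A_def by (rule atypical_prob[OF P sets B law]; assumption)+
  have D0: "0 \<le> D" by (simp add: D_def)
  have D_eq: "D = \<epsilon> * exp (real n * ln (real K + 1))" by (simp only: D_def \<epsilon>_def exp_add)
  have sym: "gaussian_weight \<zeta> \<sigma> y i j = gaussian_weight \<zeta> \<sigma> y j i" for y i j
    by (simp add: gaussian_weight_def dist_commute)
  have f0: "0 \<le> gaussian_weight \<zeta> \<sigma> y i j" for y i j using \<zeta> by (simp add: gaussian_weight_def)
  have F_le_n: "F y \<le> real n" for y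
    unfolding F_def by (rule posterior_expectation_hamming_le[where f = "gaussian_weight \<zeta> \<sigma> y" and r = r, OF sym f0 r])
  have F_le_D: "F y \<le> D"
    if y: "y \<in> space P" "y \<notin> A"
      and ry: "c1 \<le> Min ((\<lambda>i. r (y i)) ` {1..n})" "Max ((\<lambda>i. r (y i)) ` {1..n}) \<le> c2" for y
  proof (cases "b < a")
    case False
    have K1: "1 \<le> K" by (rule block_family_pos[OF B n])
    have "real n \<le> 2 ^ n" using of_nat_less_two_power[of n, where 'a = real] by simp
    also have "\<dots> = exp (real n * ln 2)" by (simp add: exp_of_nat_mult)
    also have "\<dots> \<le> exp (real n * ln (real K + 1))"
      using K1 by (subst exp_le_cancel_iff) (auto intro!: mult_left_mono)
    also have "\<dots> \<le> D"
    proof -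
      have "0 \<le> - (a - b) / (2 * \<sigma>\<^sup>2)" using False by simp
      then have "1 \<le> \<epsilon>" by (simp only: \<epsilon>_def one_le_exp_iff)
      then show ?thesis unfolding D_eq using mult_right_mono[of 1 \<epsilon> "exp (real n * ln (real K + 1))"] by simp
    qed
    finally show ?thesis using F_le_n[of y] by linarith
  next
    case True
    \<comment> \<open>\<open>m\<close> is the weight of an edge at squared distance
      \<open>b\<close>; then \<open>\<epsilon> * m\<close> is the weight at squared distance
      \<open>a\<close>.\<close>
    define m where "m = \<zeta> \<sigma> * exp (- b / (2 * \<sigma>\<^sup>2))"
    have m: "0 < m" using \<zeta> by (simp add: m_def)
    \<comment> \<open>The gap condition says precisely that \<open>\<epsilon>\<close> is at most
      \<open>1 / n ^ 2\<close>.\<close>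
    have "- (a - b) / (2 * \<sigma>\<^sup>2) \<le> - (2 * ln (real n))"
      using gap[OF True] by (simp only: minus_divide_left[symmetric] neg_le_iff_le)
    then have "\<epsilon> \<le> exp (- (2 * ln (real n)))" unfolding \<epsilon>_def by (simp only: exp_le_cancel_iff)
    also have "\<dots> = inverse (real n ^ 2)"
      using n exp_of_nat_mult[of 2 "ln (real n)"] by (simp add: exp_minus)
    finally have "real n ^ 2 * \<epsilon> \<le> real n ^ 2 * inverse (real n ^ 2)" by (intro mult_left_mono) auto
    then have \<epsilon>1: "real n ^ 2 * \<epsilon> \<le> 1" using n by simp
    have typical: "if label K B s = label K B t then (dist (y s) (y t))\<^sup>2 \<le> b else a \<le> (dist (y s) (y t))\<^sup>2"
      if "s \<in> {1..n}" "t \<in> {1..n}" "s \<noteq> t" for s t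
    proof -
      have "y \<notin> atypical_pair P B K a b s t" using y(2) that unfolding A_def by blast
      then show ?thesis using y(1) by (auto simp: atypical_pair_def not_less split: if_splits)
    qed
    have "F y \<le> 2 * real n ^ 3 * (real n ^ 2 * (c2 / c1)) ^ K * \<epsilon>"
      unfolding F_def
    proof (rule posterior_expectation_hamming_separated[where f = "gaussian_weight \<zeta> \<sigma> y" and r = r, OF B sym f0 m _ \<epsilon>1 _ _ r c1])
      show "0 \<le> \<epsilon>" by (simp add: \<epsilon>_def)
      show "m \<le> gaussian_weight \<zeta> \<sigma> y i j"
        if "i \<in> {1..n}" "j \<in> {1..n}" "i \<noteq> j" "label K B i = label K B j" for i j
      proof -
        have "(dist (y i) (y j))\<^sup>2 / (2 * \<sigma>\<^sup>2) \<le> b / (2 * \<sigma>\<^sup>2)"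
          using typical[OF that(1-3)] that(4) by (intro divide_right_mono) auto
        then show ?thesis using \<zeta> by (simp add: m_def gaussian_weight_def)
      qed
      show "gaussian_weight \<zeta> \<sigma> y i j \<le> \<epsilon> * m"
        if "i \<in> {1..n}" "j \<in> {1..n}" "label K B i \<noteq> label K B j" for i j
      proof -
        have "a / (2 * \<sigma>\<^sup>2) \<le> (dist (y i) (y j))\<^sup>2 / (2 * \<sigma>\<^sup>2)"
          using typical[OF that(1,2)] that(3) by (intro divide_right_mono) (auto split: if_splits)
        then have "gaussian_weight \<zeta> \<sigma> y i j \<le> \<zeta> \<sigma> * exp (- a / (2 * \<sigma>\<^sup>2))"
          using \<zeta> by (simp add: gaussian_weight_def)
        also have "\<dots> = \<epsilon> * m"
          by (simp add: \<epsilon>_def m_def exp_add[symmetric] mult.left_commute diff_divide_distrib)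
        finally show ?thesis .
      qed
      show "c1 \<le> r (y i)" if "i \<in> {1..n}" for i
        using ry(1) that by (intro order_trans[OF ry(1)] Min_le) auto
      show "r (y i) \<le> c2" if "i \<in> {1..n}" for i
        using that by (intro order_trans[OF _ ry(2)] Max_ge) auto
    qed
    also have "\<dots> \<le> D"
      unfolding D_eq mult.commute[of \<epsilon>] by (rule mult_right_mono[OF poly]) (simp add: \<epsilon>_def)
    finally show ?thesis .
  qed
  have "(\<integral>\<^sup>+ y. ennreal (F y) \<partial>P) \<le> (\<integral>\<^sup>+ y. ennreal D + ennreal (real n) * indicator A y \<partial>P)"
  proof (rule nn_integral_mono_AE)
    show "AE y in P. ennreal (F y) \<le> ennreal D + ennreal (real n) * indicator A y"
      using rc AE_space
    proof eventually_elim
      case (elim y)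
      show ?case
      proof (cases "y \<in> A")
        case True
        have "ennreal (F y) \<le> ennreal (real n)" by (intro ennreal_leI F_le_n)
        then show ?thesis using True by (simp add: add_increasing)
      next
        case False
        then show ?thesis using F_le_D elim by (auto intro!: ennreal_leI)
      qed
    qed
  qed
  also have "\<dots> = ennreal D + ennreal (real n) * emeasure P A"
    using A(1) by (simp add: nn_integral_add nn_integral_cmult emeasure_space_1)
  also have "\<dots> = ennreal (D + real n * measure P A)"
    using D0 by (simp add: emeasure_eq_measure ennreal_mult')
  also have "\<dots> \<le> ennreal (D + real n * (real n ^ 2 * ?q))"
    using A(2) by (intro ennreal_leI add_left_mono mult_left_mono) auto
  also have "real n * (real n ^ 2 * ?q) = real n ^ 3 * ?q" by (simp add: power2_eq_square power3_eq_cube)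
  finally show ?thesis by (simp only: F_def D_def)
qed

theorem theorem3p7:
  fixes V0 :: "nat \<Rightarrow> nat set"
    and lab :: "nat \<Rightarrow> nat \<Rightarrow> nat"
    and P0 :: "nat \<Rightarrow> (nat \<Rightarrow> 'a::{metric_space, second_countable_topology}) measure"
    and \<zeta> :: "real \<Rightarrow> real"
    and r :: "nat \<Rightarrow> 'a \<Rightarrow> real"
    and \<delta> \<sigma> a b :: "nat \<Rightarrow> real"
  assumes oracle_disjoint: "disjoint_family_on V0 {1..}"
    and oracle_cover: "(\<Union>k\<in>{1..}. V0 k) = {1..}"
    and labelling: "\<And>n. bij_betw (lab n) {1..oracle_K V0 n} (oracle_indices V0 n)"
    and data_space:
      "(\<exists>\<iota> :: 'a \<Rightarrow> real ^ 'p. euclidean_gaussian \<iota> \<zeta>) \<or>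
       (\<exists>(A :: ('a, 'p) chart set) g vol. riemannian_gaussian A g vol \<zeta>)"
    and data_prob: "\<And>n. prob_space (P0 n)"
    and data_sets: "\<And>n. sets (P0 n) = sets (Pi\<^sub>M {1..n} (\<lambda>_. borel))"
    and pair_laws: "\<And>n s t s' t'. {s, t, s', t'} \<subseteq> {1..n} \<Longrightarrow> s \<noteq> t \<Longrightarrow> s' \<noteq> t' \<Longrightarrow>
      same_cluster V0 s s' \<Longrightarrow> same_cluster V0 t t' \<Longrightarrow> pair_law (P0 n) s t = pair_law (P0 n) s' t'"
    and sigma_pos: "\<And>n. \<sigma> n > 0"
    and delta_pos: "\<And>n. \<delta> n > 0"
    and root_pos: "\<And>n x. r n x > 0"
    and A1: "\<exists>C1>0. \<exists>C2>0. \<forall>\<^sub>F n in sequentially. AE y in P0 n.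
      C1 * \<delta> n \<le> Min ((\<lambda>i. r n (y i)) ` {1..n}) \<and>
      Max ((\<lambda>i. r n (y i)) ` {1..n}) \<le> C2 * \<delta> n"
    and A2: "(\<lambda>n. real (oracle_K V0 n)) \<in> o(\<lambda>n. sqrt (real n))"
    and a_pos: "\<And>n. a n > 0"
    and b_pos: "\<And>n. b n > 0"
    and rate: "(\<lambda>n. (\<sigma> n)\<^sup>2 * ln (real n) / (a n - b n)) \<in> o(\<lambda>_. 1)"
  shows "\<exists>C>0. \<forall>\<^sub>F n in sequentially.
    (\<integral>\<^sup>+ y. ennreal (posterior_expectation (gaussian_weight \<zeta> (\<sigma> n) y) (r n) y n (oracle_K V0 n)
        (\<lambda>W. real (hamming n (oracle_K V0 n) W (oracle_block V0 lab n)))) \<partial>P0 n)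
    \<le> ennreal (C *
        (exp (- (a n - b n) / (2 * (\<sigma> n)\<^sup>2) + real n * ln (real (oracle_K V0 n) + 1)) +
         real n ^ 3 *
          (between_prob (P0 n) (oracle_block V0 lab n) (oracle_K V0 n) (a n) +
           within_prob (P0 n) (oracle_block V0 lab n) (oracle_K V0 n) (b n))))"
proof -
  obtain C1 C2 where C: "C1 > 0" "C2 > 0"
    and A1': "\<forall>\<^sub>F n in sequentially. AE y in P0 n.
      C1 * \<delta> n \<le> Min ((\<lambda>i. r n (y i)) ` {1..n}) \<and>
      Max ((\<lambda>i. r n (y i)) ` {1..n}) \<le> C2 * \<delta> n"
    using A1 by blast
  \<comment> \<open>The scale \<open>\<delta> n\<close> cancels in the ratio of the two root bounds;
    the maximum with 1 meets the assumption of
    \<open>eventually_polynomial_power_le\<close>.\<close>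
  define c where "c = max 1 (C2 / C1)"
  have "\<forall>\<^sub>F n in sequentially. real (oracle_K V0 n) \<le> sqrt (real n)"
    using landau_o.smallD[OF A2, of 1] by simp
  \<comment> \<open>For \<open>b n < a n\<close> the bound 1/4 rearranges to
    \<open>2 * ln n \<le> (a n - b n) / (2 * (\<sigma> n)\<^sup>2)\<close>.\<close>
  moreover have "\<forall>\<^sub>F n in sequentially. \<bar>(\<sigma> n)\<^sup>2 * ln (real n) / (a n - b n)\<bar> \<le> 1 / 4"
    using landau_o.smallD[OF rate, of "1 / 4"] by simp
  moreover have "\<forall>\<^sub>F n in sequentially. \<forall>K. 1 \<le> K \<longrightarrow> real K \<le> sqrt (real n) \<longrightarrow>
      2 * real n ^ 3 * (real n ^ 2 * c) ^ K \<le> exp (real n * ln (real K + 1))"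
    by (rule eventually_polynomial_power_le) (simp add: c_def)
  \<comment> \<open>The constant 1 suffices, because all constants and powers of \<open>n\<close>
    have been absorbed into the term \<open>n * ln (K + 1)\<close> in the exponent.\<close>
  ultimately have "\<forall>\<^sub>F n in sequentially.
    (\<integral>\<^sup>+ y. ennreal (posterior_expectation (gaussian_weight \<zeta> (\<sigma> n) y) (r n) y n (oracle_K V0 n)
        (\<lambda>W. real (hamming n (oracle_K V0 n) W (oracle_block V0 lab n)))) \<partial>P0 n)
    \<le> ennreal (1 *
        (exp (- (a n - b n) / (2 * (\<sigma> n)\<^sup>2) + real n * ln (real (oracle_K V0 n) + 1)) +
         real n ^ 3 *
          (between_prob (P0 n) (oracle_block V0 lab n) (oracle_K V0 n) (a n) +
           within_prob (P0 n) (oracle_block V0 lab n) (oracle_K V0 n) (b n))))"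
    using A1' eventually_ge_at_top[of 1]
  proof eventually_elim
    case (elim n)
    let ?K = "oracle_K V0 n" and ?B = "oracle_block V0 lab n"
    have B: "block_family n ?K ?B" by (rule oracle_block_family[OF oracle_disjoint oracle_cover labelling])
    have law: "pair_law (P0 n) s t = pair_law (P0 n) s' t'"
      if st: "{s, t, s', t'} \<subseteq> {1..n}" "s \<noteq> t" "s' \<noteq> t'"
        and lab: "label ?K ?B s = label ?K ?B s'" "label ?K ?B t = label ?K ?B t'" for s t s' t'
    proof (rule pair_laws[OF st])
      have mem: "s \<in> {1..n}" "t \<in> {1..n}" "s' \<in> {1..n}" "t' \<in> {1..n}" using st(1) by blast+
      show "same_cluster V0 s s'"
        using label_mem[OF B mem(1)] label_mem[OF B mem(3)] lab(1)
        by (intro same_cluster_label[OF B labelling]) simp_all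
      show "same_cluster V0 t t'"
        using label_mem[OF B mem(2)] label_mem[OF B mem(4)] lab(2)
        by (intro same_cluster_label[OF B labelling]) simp_all
    qed
    have gap: "2 * ln (real n) \<le> (a n - b n) / (2 * (\<sigma> n)\<^sup>2)" if "b n < a n"
    proof -
      have "(\<sigma> n)\<^sup>2 * ln (real n) / (a n - b n) \<le> 1 / 4" using elim(2) by linarith
      then show ?thesis using that sigma_pos[of n] by (simp add: field_simps)
    qed
    have poly: "2 * real n ^ 3 * (real n ^ 2 * (C2 * \<delta> n / (C1 * \<delta> n))) ^ ?K
        \<le> exp (real n * ln (real ?K + 1))"
    proof -
      have "C2 * \<delta> n / (C1 * \<delta> n) = C2 / C1" using delta_pos[of n] by simp
      then have "2 * real n ^ 3 * (real n ^ 2 * (C2 * \<delta> n / (C1 * \<delta> n))) ^ ?K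
          \<le> 2 * real n ^ 3 * (real n ^ 2 * c) ^ ?K"
        using C by (intro mult_left_mono power_mono) (auto simp: c_def)
      also have "\<dots> \<le> exp (real n * ln (real ?K + 1))"
        using elim(1,3) block_family_pos[OF B elim(5)] by blast
      finally show ?thesis .
    qed
    have c1: "0 < C1 * \<delta> n" using C(1) delta_pos[of n] by simp
    show ?case
      unfolding mult_1
      by (rule expected_hamming_le[where \<zeta> = \<zeta> and \<sigma> = "\<sigma> n" and r = "r n"
            and ?c1.0 = "C1 * \<delta> n" and ?c2.0 = "C2 * \<delta> n" and n = n, OF data_prob data_sets elim(5) B law
            gaussian_constant_pos[OF data_space sigma_pos] sigma_pos root_pos c1 elim(4) gap poly])
  qed
  then show ?thesis by (intro exI[of _ 1] conjI) simp_all
qed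

end
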